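(* Let $k$ be an infinite field and $m$ a positive integer. Let $\pi_1,\pi_2$ be permutations of the $m$ coordinates of $k^m$ (viewed as linear endomorphisms of $k^m$) and let $\rho_1,\rho_2$ be coordinate projections of $k^m$. Set $\sigma_1=\rho_2\rho_1\pi_1$ and $\sigma_2=\rho_2\pi_2$, with matrices $S_1,S_2\in k^{m\times m}$ in the canonical basis. Let $k[x]=k[x_1,\dots,x_m]$, $x=(x_1,\dots,x_m)^\top$, let $I$ be the ideal of $k[x]$ generated by the $2\times2$ minors of the $m\times 2$ matrix $[\,S_1x\;\;S_2x\,]$, and let $$U_{\rho_2\rho_1\pi_1,\rho_2\pi_2}=\operatorname{Spec}(k[x]/I)\setminus\Big(\overline{\ker(\sigma_1-\sigma_2)}\cup\overline{\ker(\sigma_1)}\cup\overline{\ker(\sigma_2)}\Big).$$ Then $\dim U_{\rho_2\rho_1\pi_1,\rho_2\pi_2}\le m-\lfloor \operatorname{rank}(\rho_2)/2\rfloor$.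
   Context: A coordinate projection of $k^m$ is an endomorphism of $k^m$ that preserves the values of $\operatorname{rank}(\rho)$ of the coordinates and sets the remaining coordinates to zero (i.e. it is given by a diagonal matrix with entries in $\{0,1\}$). For a $k$-subspace $V\subseteq k^m$, $I_V\subseteq k[x]$ is the ideal of polynomials vanishing on $V$ and $\overline{V}=\operatorname{Spec}(k[x]/I_V)\subseteq\mathbb{A}^m_k$; the removed set is closed, so $U$ is an open subscheme of $\operatorname{Spec}(k[x]/I)$, and $\dim$ is its Krull dimension. *)

theory Defs
  imports
    "HOL-Analysis.Analysis"
    "HOL-Algebra.Algebra"
    "HOL-Library.Poly_Mapping"
begin

section \<open>Spectra of commutative rings\<close>

definition Spec :: "('a, 'b) ring_scheme \<Rightarrow> 'a set set" where
  "Spec R = {P. primeideal P R}"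

definition zariski_topology :: "('a, 'b) ring_scheme \<Rightarrow> 'a set topology" where
  "zariski_topology R =
     topology (\<lambda>W. \<exists>S. S \<subseteq> carrier R \<and> W = {P \<in> Spec R. \<not> S \<subseteq> P})"

lemma istopology_zariski:
  "istopology (\<lambda>W. \<exists>S. S \<subseteq> carrier R \<and> W = {P \<in> Spec R. \<not> S \<subseteq> P})"
  unfolding istopology_def
proof (intro conjI allI impI)
  fix V W
  assume "\<exists>S. S \<subseteq> carrier R \<and> V = {P \<in> Spec R. \<not> S \<subseteq> P}"
    and "\<exists>S. S \<subseteq> carrier R \<and> W = {P \<in> Spec R. \<not> S \<subseteq> P}"
  then obtain S T where S: "S \<subseteq> carrier R" "V = {P \<in> Spec R. \<not> S \<subseteq> P}"
    and T: "T \<subseteq> carrier R" "W = {P \<in> Spec R. \<not> T \<subseteq> P}"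
    by blast
  define ST where "ST = {s \<otimes>\<^bsub>R\<^esub> t | s t. s \<in> S \<and> t \<in> T}"
  have eq: "\<not> ST \<subseteq> P \<longleftrightarrow> \<not> S \<subseteq> P \<and> \<not> T \<subseteq> P" if "P \<in> Spec R" for P
  proof -
    interpret primeideal P R using that by (simp add: Spec_def)
    show ?thesis
    proof
      assume "\<not> ST \<subseteq> P"
      then obtain s t where "s \<in> S" "t \<in> T" "s \<otimes>\<^bsub>R\<^esub> t \<notin> P" unfolding ST_def by blast
      then show "\<not> S \<subseteq> P \<and> \<not> T \<subseteq> P"
        using S(1) T(1) I_l_closed I_r_closed by blast
    next
      assume "\<not> S \<subseteq> P \<and> \<not> T \<subseteq> P"
      then obtain s t where "s \<in> S" "t \<in> T" "s \<notin> P" "t \<notin> P" by blast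
      then show "\<not> ST \<subseteq> P" unfolding ST_def using I_prime S(1) T(1) by blast
    qed
  qed
  have sub: "ST \<subseteq> carrier R" if "P \<in> Spec R" for P
  proof -
    interpret primeideal P R using that by (simp add: Spec_def)
    show ?thesis using S(1) T(1) by (auto simp: ST_def)
  qed
  show "\<exists>S. S \<subseteq> carrier R \<and> V \<inter> W = {P \<in> Spec R. \<not> S \<subseteq> P}"
  proof (cases "Spec R = {}")
    case True
    then show ?thesis using S T by auto
  next
    case False
    then have "ST \<subseteq> carrier R" using sub by blast
    moreover have "V \<inter> W = {P \<in> Spec R. \<not> ST \<subseteq> P}"
      unfolding S(2) T(2) using eq by blast
    ultimately show ?thesis by blast
  qed
next
  fix \<K>
  assume "\<forall>K\<in>\<K>. \<exists>S. S \<subseteq> carrier R \<and> K = {P \<in> Spec R. \<not> S \<subseteq> P}"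
  then obtain f where f: "\<And>K. K \<in> \<K> \<Longrightarrow> f K \<subseteq> carrier R \<and> K = {P \<in> Spec R. \<not> f K \<subseteq> P}"
    by metis
  have "\<Union>\<K> = {P \<in> Spec R. \<not> (\<Union>K\<in>\<K>. f K) \<subseteq> P}"
  proof (intro Set.set_eqI iffI)
    fix P assume "P \<in> \<Union>\<K>"
    then obtain K where "K \<in> \<K>" "P \<in> K" by blast
    then show "P \<in> {P \<in> Spec R. \<not> (\<Union>K\<in>\<K>. f K) \<subseteq> P}" using f[of K] by blast
  next
    fix P assume "P \<in> {P \<in> Spec R. \<not> (\<Union>K\<in>\<K>. f K) \<subseteq> P}"
    then obtain K where "K \<in> \<K>" "P \<in> Spec R" "\<not> f K \<subseteq> P" by blast
    then show "P \<in> \<Union>\<K>" using f[of K] by blast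
  qed
  then show "\<exists>S. S \<subseteq> carrier R \<and> \<Union>\<K> = {P \<in> Spec R. \<not> S \<subseteq> P}"
    using f by (intro exI[of _ "\<Union>K\<in>\<K>. f K"] conjI UN_least) blast+
qed

lemma openin_zariski:
  "openin (zariski_topology R) W \<longleftrightarrow> (\<exists>S. S \<subseteq> carrier R \<and> W = {P \<in> Spec R. \<not> S \<subseteq> P})"
  unfolding zariski_topology_def by (simp add: istopology_zariski topology_inverse')

text \<open>The underlying set of the closed subscheme \<open>Spec (R/J)\<close> of \<open>Spec R\<close>: the image of the
  closed immersion induced by \<open>R \<rightarrow> R/J\<close>, which pulls back primes of \<open>R/J\<close>.\<close>

definition Spec_quot :: "('a, 'b) ring_scheme \<Rightarrow> 'a set \<Rightarrow> 'a set set" where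
  "Spec_quot R J = (\<lambda>Q. {r \<in> carrier R. J +>\<^bsub>R\<^esub> r \<in> Q}) ` Spec (R Quot J)"

lemma (in cring) Spec_quot_eq:
  assumes J: "ideal J R"
  shows "Spec_quot R J = {P \<in> Spec R. J \<subseteq> P}"
proof -
  interpret J: ideal J R by (rule J)
  interpret h: ring_hom_ring R "R Quot J" "(+>) J" by (rule J.rcos_ring_hom_ring)
  have cQ: "cring (R Quot J)" by (rule J.quotient_is_cring[OF is_cring])
  have carQ: "carrier (R Quot J) = (+>) J ` carrier R"
    unfolding FactRing_def using A_RCOSETS_def'[of R J] by auto
  show ?thesis
  proof (intro Set.set_eqI iffI)
    fix P assume "P \<in> Spec_quot R J"
    then obtain Q where Q: "primeideal Q (R Quot J)" and P: "P = {r \<in> carrier R. J +> r \<in> Q}"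
      by (auto simp: Spec_quot_def Spec_def)
    have "primeideal P R"
      unfolding P by (rule h.primeideal_vimage[OF is_cring Q])
    moreover have "J \<subseteq> P"
    proof
      fix r assume r: "r \<in> J"
      then have "J +> r = \<zero>\<^bsub>R Quot J\<^esub>"
        unfolding FactRing_def ring.simps by (rule J.a_rcos_const)
      moreover have "\<zero>\<^bsub>R Quot J\<^esub> \<in> Q"
        by (rule additive_subgroup.zero_closed[OF ideal.axioms(1)[OF primeideal.axioms(1)[OF Q]]])
      ultimately show "r \<in> P" using r by (simp add: P J.a_Hcarr)
    qed
    ultimately show "P \<in> {P \<in> Spec R. J \<subseteq> P}" by (simp add: Spec_def)
  next
    fix P assume "P \<in> {P \<in> Spec R. J \<subseteq> P}"
    then have prime: "primeideal P R" and JP: "J \<subseteq> P" by (auto simp: Spec_def)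
    interpret P: primeideal P R by (rule prime)
    define Q where "Q = (+>) J ` P"
    have mem: "J +> r \<in> Q \<longleftrightarrow> r \<in> P" if r: "r \<in> carrier R" for r
    proof
      assume "J +> r \<in> Q"
      then obtain p where p: "p \<in> P" "J +> r = J +> p" by (auto simp: Q_def)
      then have "r \<in> J +> p" using J.a_rcos_self[OF r] by simp
      then obtain j where "j \<in> J" "r = j \<oplus> p" by (auto simp: a_r_coset_def r_coset_def)
      then show "r \<in> P" using JP p(1) P.a_closed by blast
    qed (simp add: Q_def)
    have "primeideal Q (R Quot J)"
    proof (rule primeidealI)
      show "ideal Q (R Quot J)"
        unfolding Q_def by (rule ring_ideal_imp_quot_ideal[OF J P.is_ideal])
      show "cring (R Quot J)" by (rule cQ)
      show "carrier (R Quot J) \<noteq> Q"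
      proof
        assume "carrier (R Quot J) = Q"
        then have "carrier R \<subseteq> P" using mem unfolding carQ by (metis imageI subsetI)
        then show False using P.I_notcarr P.a_subset by simp
      qed
      fix a b
      assume "a \<in> carrier (R Quot J)" "b \<in> carrier (R Quot J)" 
        and ab: "a \<otimes>\<^bsub>R Quot J\<^esub> b \<in> Q"
      then obtain x y where xy: "x \<in> carrier R" "y \<in> carrier R" "a = J +> x" "b = J +> y"
        unfolding carQ by blast
      have "J +> (x \<otimes> y) \<in> Q"
        by (rule ssubst[OF h.hom_mult[OF xy(1,2)], of "\<lambda>z. z \<in> Q"]) (rule ab[unfolded xy(3,4)])
      then have "x \<otimes> y \<in> P" using mem[OF m_closed[OF xy(1,2)]] by blast
      then have "x \<in> P \<or> y \<in> P" using P.I_prime xy(1,2) by blast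
      then show "a \<in> Q \<or> b \<in> Q" using mem[OF xy(1)] mem[OF xy(2)] xy(3,4) by blast
    qed
    then have "Q \<in> Spec (R Quot J)" by (simp only: Spec_def mem_Collect_eq)
    moreover have "P = {r \<in> carrier R. J +> r \<in> Q}"
    proof (intro equalityI subsetI CollectI conjI)
      fix r assume "r \<in> P"
      then show "r \<in> carrier R" "J +> r \<in> Q" using P.a_Hcarr mem by blast+
    next
      fix r assume "r \<in> {r \<in> carrier R. J +> r \<in> Q}"
      then show "r \<in> P" using mem by blast
    qed
    ultimately show "P \<in> Spec_quot R J"
      unfolding Spec_quot_def by (rule rev_image_eqI)
  qed
qed

section \<open>Krull dimension of topological spaces\<close>

definition irreducible_closedin :: "'a topology \<Rightarrow> 'a set \<Rightarrow> bool" where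
  "irreducible_closedin T Z \<longleftrightarrow> closedin T Z \<and> Z \<noteq> {} \<and>
     (\<forall>A B. closedin T A \<and> closedin T B \<and> Z = A \<union> B \<longrightarrow> A = Z \<or> B = Z)"

text \<open>The supremum is taken in the extended reals, so the empty space has dimension \<open>-\<infinity>\<close>.\<close>

definition krull_dim :: "'a topology \<Rightarrow> ereal" where
  "krull_dim T = Sup {ereal (real l) | l. \<exists>Z :: nat \<Rightarrow> 'a set.
     (\<forall>i\<le>l. irreducible_closedin T (Z i)) \<and> (\<forall>i<l. Z i \<subset> Z (Suc i))}"

section \<open>The polynomial ring \<open>k[x]\<close>\<close>

text \<open>The variables are indexed by a finite type \<open>'n\<close>; a polynomial maps exponent vectors to
  coefficients.\<close>

type_synonym ('n, 'k) mpol = "('n \<Rightarrow>\<^sub>0 nat) \<Rightarrow>\<^sub>0 'k"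

definition polring :: "('n::finite, 'k::field) mpol ring" where
  "polring = \<lparr>carrier = UNIV, mult = (*), one = 1, ring.zero = 0, add = (+)\<rparr>"

lemma cring_polring: "cring (polring :: ('n::finite, 'k::field) mpol ring)"
proof (rule cringI)
  show "abelian_group (polring :: ('n, 'k) mpol ring)"
  proof (rule abelian_groupI)
    fix x :: "('n, 'k) mpol"
    show "\<exists>y\<in>carrier polring. y \<oplus>\<^bsub>polring\<^esub> x = \<zero>\<^bsub>polring\<^esub>"
      by (rule bexI[of _ "- x"]) (simp_all add: polring_def)
  qed (simp_all add: polring_def algebra_simps)
  show "comm_monoid (polring :: ('n, 'k) mpol ring)"
    by (rule comm_monoidI) (simp_all add: polring_def algebra_simps)
qed (simp add: polring_def algebra_simps)

definition mconst :: "'k::field \<Rightarrow> ('n::finite, 'k) mpol" where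
  "mconst c = Poly_Mapping.single 0 c"

definition mvar :: "'n::finite \<Rightarrow> ('n, 'k::field) mpol" where
  "mvar i = Poly_Mapping.single (Poly_Mapping.single i 1) 1"

definition meval :: "('n::finite, 'k::field) mpol \<Rightarrow> 'k ^ 'n \<Rightarrow> 'k" where
  "meval f v = (\<Sum>a\<in>Poly_Mapping.keys f.
     Poly_Mapping.lookup f a * (\<Prod>i\<in>UNIV. (v $ i) ^ Poly_Mapping.lookup a i))"

definition vanishing_ideal :: "('k::field ^ 'n::finite) set \<Rightarrow> ('n, 'k) mpol set" where
  "vanishing_ideal V = {f. \<forall>v\<in>V. meval f v = 0}"

definition closure_scheme :: "('k::field ^ 'n::finite) set \<Rightarrow> ('n, 'k) mpol set set" where
  "closure_scheme V = Spec_quot polring (vanishing_ideal V)"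

section \<open>The determinantal scheme of a pair of endomorphisms\<close>

definition coord_permutation :: "('k::field ^ 'n::finite \<Rightarrow> 'k ^ 'n) \<Rightarrow> bool" where
  "coord_permutation \<pi> \<longleftrightarrow> (\<exists>p. p permutes UNIV \<and> \<pi> = (\<lambda>v. \<chi> i. v $ p i))"

definition coord_projection :: "('k::field ^ 'n::finite \<Rightarrow> 'k ^ 'n) \<Rightarrow> bool" where
  "coord_projection \<rho> \<longleftrightarrow> (\<exists>A. \<rho> = (\<lambda>v. \<chi> i. if i \<in> A then v $ i else 0))"

definition generic_image ::
  "('k::field ^ 'n::finite \<Rightarrow> 'k ^ 'n) \<Rightarrow> ('n, 'k) mpol ^ 'n" where
  "generic_image \<sigma> = (\<chi> i j. mconst (matrix \<sigma> $ i $ j)) *v (\<chi> i. mvar i)"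

definition generic_pair ::
  "('k::field ^ 'n::finite \<Rightarrow> 'k ^ 'n) \<Rightarrow> ('k ^ 'n \<Rightarrow> 'k ^ 'n) \<Rightarrow> ('n, 'k) mpol ^ 2 ^ 'n" where
  "generic_pair \<sigma>\<^sub>1 \<sigma>\<^sub>2 =
     (\<chi> i c. if c = 1 then generic_image \<sigma>\<^sub>1 $ i else generic_image \<sigma>\<^sub>2 $ i)"

definition two_minors :: "'a::comm_ring_1 ^ 2 ^ 'n::finite \<Rightarrow> 'a set" where
  "two_minors M =
     {det ((\<chi> r c. M $ (if r = 1 then i else j) $ c) :: 'a ^ 2 ^ 2) | i j. i \<noteq> j}"

definition minor_ideal ::
  "('k::field ^ 'n::finite \<Rightarrow> 'k ^ 'n) \<Rightarrow> ('k ^ 'n \<Rightarrow> 'k ^ 'n) \<Rightarrow> ('n, 'k) mpol set" where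
  "minor_ideal \<sigma>\<^sub>1 \<sigma>\<^sub>2 = Idl\<^bsub>polring\<^esub> (two_minors (generic_pair \<sigma>\<^sub>1 \<sigma>\<^sub>2))"

definition U_points ::
  "('k::field ^ 'n::finite \<Rightarrow> 'k ^ 'n) \<Rightarrow> ('k ^ 'n \<Rightarrow> 'k ^ 'n) \<Rightarrow> ('n, 'k) mpol set set" where
  "U_points \<sigma>\<^sub>1 \<sigma>\<^sub>2 = Spec_quot polring (minor_ideal \<sigma>\<^sub>1 \<sigma>\<^sub>2) -
     (closure_scheme {v. \<sigma>\<^sub>1 v - \<sigma>\<^sub>2 v = 0} \<union> closure_scheme {v. \<sigma>\<^sub>1 v = 0} \<union>
      closure_scheme {v. \<sigma>\<^sub>2 v = 0})"

text \<open>As \<open>Spec (k[x]/I)\<close> is a closed subscheme of affine space, the topology of its open subscheme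
  \<open>U\<close> is the one induced from the Zariski topology of affine space.\<close>

definition U_space ::
  "('k::field ^ 'n::finite \<Rightarrow> 'k ^ 'n) \<Rightarrow> ('k ^ 'n \<Rightarrow> 'k ^ 'n) \<Rightarrow> ('n, 'k) mpol set topology" where
  "U_space \<sigma>\<^sub>1 \<sigma>\<^sub>2 = subtopology (zariski_topology polring) (U_points \<sigma>\<^sub>1 \<sigma>\<^sub>2)"

end

theory Submission
  imports Defs "HOL-Computational_Algebra.Polynomial"
begin

text \<open>An irreducible closed subset of \<open>U\<close> has its generic point \<open>P\<close> in \<open>U\<close>. Modulo \<open>P\<close> the vectors
  \<open>\<sigma>\<^sub>1 x\<close> and \<open>\<sigma>\<^sub>2 x\<close> are nonzero and proportional with a ratio \<open>\<lambda> = a / b \<noteq> 1\<close>, where \<open>a\<close> and \<open>b\<close> are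
  coordinates. Hence \<open>x\<^bsub>p\<^sub>1 i\<^esub> = \<lambda> x\<^bsub>p\<^sub>2 i\<^esub>\<close> for each coordinate \<open>i\<close> kept by both projections, and
  \<open>x\<^bsub>p\<^sub>2 i\<^esub> = 0\<close> for those killed by \<open>\<rho>\<^sub>1\<close> alone. In a minimal set \<open>S\<close> of coordinates of which all
  nonzero coordinates are \<open>\<lambda>\<close>-power multiples, no relation joins two distinct elements. If \<open>\<lambda>\<close> is a
  root of unity, this gives \<open>card S \<le> m - rank \<rho>\<^sub>2 / 2\<close>; otherwise there are no cycles and
  \<open>card S \<le> m - rank \<rho>\<^sub>2\<close>, but \<open>\<lambda>\<close> may contribute one more parameter.

  Transcendence degrees are replaced by counting. A chain of \<open>l\<close> strict inclusions of primes above \<open>P\<close>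
  yields about \<open>N ^ l\<close> polynomials with exponents \<open>O(N)\<close> that are linearly independent modulo \<open>P\<close>,
  whereas, after multiplication by a power of \<open>b\<close>, all of them lie in the span of \<open>O(N ^ d)\<close> products
  of \<open>a\<close>, \<open>b\<close> and the coordinates in \<open>S\<close>, where \<open>d\<close> is \<open>card S\<close> or \<open>card S + 1\<close>.\<close>

section \<open>Prime ideals of commutative rings\<close>

text \<open>Type-class counterpart of \<open>primeideal\<close>, so that ordinary ring arithmetic
  and its simplification apply. Negation is multiplication by -1.\<close>

locale comm_prime_ideal =
  fixes P :: "'a::comm_ring_1 set"
  assumes zero_mem: "0 \<in> P"
    and add_mem: "f \<in> P \<Longrightarrow> g \<in> P \<Longrightarrow> f + g \<in> P"
    and mult_mem: "f \<in> P \<Longrightarrow> g * f \<in> P"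
    and one_not_mem: "1 \<notin> P"
    and prime_mem: "f * g \<in> P \<Longrightarrow> f \<in> P \<or> g \<in> P"
begin

lemma mult_mem': "f \<in> P \<Longrightarrow> f * g \<in> P"
  using mult_mem[of f g] by (simp add: mult.commute)

lemma diff_mem: "f \<in> P \<Longrightarrow> g \<in> P \<Longrightarrow> f - g \<in> P"
  using add_mem[of f "- g"] mult_mem[of g "- 1"] by simp

lemma sum_mem: "(\<And>i. i \<in> A \<Longrightarrow> f i \<in> P) \<Longrightarrow> (\<Sum>i\<in>A. f i) \<in> P"
  by (induction A rule: infinite_finite_induct) (auto simp: zero_mem intro: add_mem)

lemma power_mem_iff: "f ^ n \<in> P \<longleftrightarrow> f \<in> P \<and> n > 0"
  by (induction n) (use one_not_mem prime_mem mult_mem' in auto)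

text \<open>Congruence modulo \<open>P\<close> lets computations in the quotient run on
  representatives, without forming the quotient ring.\<close>

definition eqmod :: "'a \<Rightarrow> 'a \<Rightarrow> bool" (infix "\<doteq>" 50)
  where "f \<doteq> g \<longleftrightarrow> f - g \<in> P"

lemma eqmod_refl [simp]: "f \<doteq> f"
  by (simp add: eqmod_def zero_mem)

lemma eqmod_sym: "f \<doteq> g \<Longrightarrow> g \<doteq> f"
  unfolding eqmod_def using diff_mem[OF zero_mem, of "f - g"] by simp

lemma eqmod_trans [trans]: "f \<doteq> g \<Longrightarrow> g \<doteq> h \<Longrightarrow> f \<doteq> h"
  unfolding eqmod_def using add_mem[of "f - g" "g - h"] by simp

lemma eqmod_0: "f \<doteq> 0 \<longleftrightarrow> f \<in> P"
  by (simp add: eqmod_def)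

lemma eqmod_mem: "f \<doteq> g \<Longrightarrow> f \<in> P \<longleftrightarrow> g \<in> P"
  using eqmod_trans[of f g 0] eqmod_trans[of g f 0] eqmod_sym[of f g] by (auto simp: eqmod_0)

lemma eqmod_mult:
  assumes "f \<doteq> f'" "g \<doteq> g'"
  shows "f * g \<doteq> f' * g'"
proof -
  have "f * g - f' * g' = f * (g - g') + g' * (f - f')"
    by (simp add: algebra_simps)
  then show ?thesis
    using assms add_mem mult_mem unfolding eqmod_def by metis
qed

lemma eqmod_power: "f \<doteq> g \<Longrightarrow> f ^ n \<doteq> g ^ n"
  by (induction n) (auto intro: eqmod_mult)

lemma eqmod_prod: "(\<And>i. i \<in> A \<Longrightarrow> f i \<doteq> g i) \<Longrightarrow> (\<Prod>i\<in>A. f i) \<doteq> (\<Prod>i\<in>A. g i)"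
  by (induction A rule: infinite_finite_induct) (auto intro: eqmod_mult)

lemma eqmod_sum: "(\<And>i. i \<in> A \<Longrightarrow> f i \<doteq> g i) \<Longrightarrow> (\<Sum>i\<in>A. f i) \<doteq> (\<Sum>i\<in>A. g i)"
  unfolding eqmod_def sum_subtractf[symmetric] by (rule sum_mem)

end

section \<open>Prime ideals of the polynomial ring in both formalisms\<close>

lemma comm_prime_ideal_of_primeideal:
  assumes "primeideal P polring"
  shows "comm_prime_ideal (P :: ('n::finite, 'k::field) mpol set)"
proof -
  interpret primeideal P polring by (rule assms)
  show ?thesis
  proof
    show "0 \<in> P"
      using additive_subgroup.zero_closed[OF is_additive_subgroup] by (simp add: polring_def)
    show "f + g \<in> P" if "f \<in> P" "g \<in> P" for f g
      using additive_subgroup.a_closed[OF is_additive_subgroup that] by (simp add: polring_def)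
    show "g * f \<in> P" if "f \<in> P" for f g
      using I_l_closed[OF that, of g] by (simp add: polring_def)
    show "f \<in> P \<or> g \<in> P" if "f * g \<in> P" for f g
      using I_prime[of f g] that by (simp add: polring_def)
    show "1 \<notin> P"
      using I_notcarr one_imp_carrier by (auto simp: polring_def)
  qed
qed

lemma ideal_polringI:
  fixes I :: "('n::finite, 'k::field) mpol set"
  assumes "0 \<in> I" "\<And>f g. f \<in> I \<Longrightarrow> g \<in> I \<Longrightarrow> f + g \<in> I" "\<And>f g. f \<in> I \<Longrightarrow> g * f \<in> I"
  shows "ideal I polring"
proof -
  interpret R: cring "polring :: ('n, 'k) mpol ring" by (rule cring_polring)
  show ?thesis
  proof (rule idealI)
    show "subgroup I (add_monoid polring)"
    proof (rule R.add.subgroupI)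
      fix f assume f: "f \<in> I"
      have "\<ominus>\<^bsub>polring\<^esub> f = - f"
        by (intro R.minus_equality) (auto simp: polring_def)
      then show "\<ominus>\<^bsub>polring\<^esub> f \<in> I"
        using assms(3)[OF f, of "- 1"] by simp
    qed (use assms in \<open>auto simp: polring_def\<close>)
  qed (use assms(3) R.ring_axioms in \<open>simp_all add: polring_def mult.commute\<close>)
qed

lemma primeideal_iff_comm_prime_ideal:
  "primeideal P polring \<longleftrightarrow> comm_prime_ideal (P :: ('n::finite, 'k::field) mpol set)"
proof
  assume "comm_prime_ideal P"
  then interpret comm_prime_ideal P .
  show "primeideal P polring"
    by (rule primeidealI)
      (use cring_polring ideal_polringI[of P] one_not_mem prime_mem zero_mem add_mem mult_mem
        in \<open>auto simp: polring_def\<close>)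
qed (rule comm_prime_ideal_of_primeideal)

section \<open>Monomials and evaluation\<close>

abbreviation mmonom :: "('n \<Rightarrow>\<^sub>0 nat) \<Rightarrow> ('n::finite, 'k::field) mpol"
  where "mmonom a \<equiv> \<Prod>i\<in>UNIV. mvar i ^ Poly_Mapping.lookup a i"

lemma mconst_0 [simp]: "mconst 0 = 0"
  by (simp add: mconst_def)

lemma mconst_1 [simp]: "mconst 1 = 1"
  by (simp add: mconst_def)

lemma mconst_add: "mconst (c + d) = mconst c + mconst d"
  by (simp add: mconst_def single_add)

lemma mconst_mult: "mconst (c * d) = mconst c * mconst d"
  by (simp add: mconst_def mult_single)

lemma mconst_sum: "mconst (\<Sum>i\<in>A. c i) = (\<Sum>i\<in>A. mconst (c i))"
  by (induction A rule: infinite_finite_induct) (auto simp: mconst_add)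

lemma mvar_power: "mvar i ^ e = Poly_Mapping.single (Poly_Mapping.single i e) 1"
proof (induction e)
  case (Suc e)
  have "Poly_Mapping.single i 1 + Poly_Mapping.single i e = Poly_Mapping.single i (Suc e)"
    by (simp flip: single_add)
  then show ?case
    unfolding power_Suc Suc by (simp add: mvar_def mult_single)
qed simp

lemma single_eq_mmonom: "Poly_Mapping.single a c = mconst c * mmonom a"
proof -
  have *: "(\<Prod>i\<in>A. Poly_Mapping.single (g i) 1) = Poly_Mapping.single (\<Sum>i\<in>A. g i) (1::'b)"
    for A and g :: "'a \<Rightarrow> 'a \<Rightarrow>\<^sub>0 nat"
    by (induction A rule: infinite_finite_induct) (auto simp: mult_single)
  have "(\<Sum>i\<in>UNIV. Poly_Mapping.single i (Poly_Mapping.lookup a i)) = a"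
    by (rule poly_mapping_eqI) (simp add: lookup_sum lookup_single when_def)
  then show ?thesis
    by (simp add: mvar_power * mconst_def mult_single)
qed

lemma mpol_expansion:
  "f = (\<Sum>a\<in>Poly_Mapping.keys f. mconst (Poly_Mapping.lookup f a) * mmonom a)"
proof -
  have "f = (\<Sum>a\<in>Poly_Mapping.keys f. Poly_Mapping.single a (Poly_Mapping.lookup f a))"
    by (rule poly_mapping_eqI) (auto simp: lookup_sum lookup_single when_def in_keys_iff)
  then show ?thesis
    unfolding single_eq_mmonom .
qed

lemma meval_superset:
  assumes "finite A" "Poly_Mapping.keys f \<subseteq> A"
  shows "meval f v = (\<Sum>a\<in>A. Poly_Mapping.lookup f a * (\<Prod>i\<in>UNIV. v $ i ^ Poly_Mapping.lookup a i))"
  unfolding meval_def using assms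
  by (intro sum.mono_neutral_left) (auto simp: in_keys_iff)

lemma meval_0 [simp]: "meval 0 v = 0"
  by (simp add: meval_def)

lemma meval_add: "meval (f + g) v = meval f v + meval g v"
proof -
  let ?A = "Poly_Mapping.keys f \<union> Poly_Mapping.keys g"
  have "Poly_Mapping.keys (f + g) \<subseteq> ?A"
    by (rule keys_add)
  then show ?thesis
    by (simp add: meval_superset[of ?A] lookup_add sum.distrib algebra_simps)
qed

lemma meval_sum: "meval (\<Sum>i\<in>A. f i) v = (\<Sum>i\<in>A. meval (f i) v)"
  by (induction A rule: infinite_finite_induct) (auto simp: meval_add)

lemma meval_single:
  "meval (Poly_Mapping.single a c) v = c * (\<Prod>i\<in>UNIV. v $ i ^ Poly_Mapping.lookup a i)"
  by (simp add: meval_superset[of "{a}"])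

lemma meval_mult: "meval (f * g) v = meval f v * meval g v"
proof -
  \<comment> \<open>Multiplicativity is bilinear in f and g, so single terms suffice; there
    exponents add.\<close>
  have single: "meval (Poly_Mapping.single a c * Poly_Mapping.single b d) v
      = meval (Poly_Mapping.single a c) v * meval (Poly_Mapping.single b d) v" for a b c d
    by (simp add: mult_single meval_single lookup_add power_add prod.distrib)
  have expand: "h = (\<Sum>a\<in>Poly_Mapping.keys h. Poly_Mapping.single a (Poly_Mapping.lookup h a))"
    for h :: "('b, 'a) mpol"
    unfolding single_eq_mmonom by (rule mpol_expansion)
  have meval_expand: "meval h v = (\<Sum>a\<in>Poly_Mapping.keys h.
      meval (Poly_Mapping.single a (Poly_Mapping.lookup h a)) v)" for h :: "('b, 'a) mpol"
    using arg_cong[OF expand[of h], of "\<lambda>h. meval h v"] by (simp only: meval_sum)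
  have "f * g = (\<Sum>a\<in>Poly_Mapping.keys f. \<Sum>b\<in>Poly_Mapping.keys g.
      Poly_Mapping.single a (Poly_Mapping.lookup f a) * Poly_Mapping.single b (Poly_Mapping.lookup g b))"
    using arg_cong2[OF expand[of f] expand[of g], of "(*)"] by (simp only: sum_product)
  then have "meval (f * g) v = (\<Sum>a\<in>Poly_Mapping.keys f. \<Sum>b\<in>Poly_Mapping.keys g.
      meval (Poly_Mapping.single a (Poly_Mapping.lookup f a)) v *
      meval (Poly_Mapping.single b (Poly_Mapping.lookup g b)) v)"
    by (simp only: meval_sum single)
  then show ?thesis
    by (simp only: meval_expand[of f] meval_expand[of g] sum_product)
qed

lemma meval_mconst [simp]: "meval (mconst c) v = c"
  by (simp add: mconst_def meval_single)

lemma meval_1 [simp]: "meval 1 v = 1"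
  using meval_mconst[of 1 v] by simp

lemma meval_power: "meval (f ^ n) v = meval f v ^ n"
  by (induction n) (auto simp: meval_mult)

lemma meval_prod: "meval (\<Prod>i\<in>A. f i) v = (\<Prod>i\<in>A. meval (f i) v)"
  by (induction A rule: infinite_finite_induct) (auto simp: meval_mult)

lemma meval_mvar [simp]: "meval (mvar j) v = v $ j"
proof -
  have "(\<Prod>i\<in>UNIV. v $ i ^ (1 when j = i)) = (\<Prod>i\<in>UNIV. if i = j then v $ i else 1)"
    by (intro prod.cong) (auto simp: when_def)
  then show ?thesis
    by (simp add: mvar_def meval_single lookup_single)
qed

section \<open>Kronecker substitution and vanishing ideals of coordinate subspaces\<close>

text \<open>The lowest digit is the residue modulo \<open>B\<close>, and the quotient by
  \<open>B\<close> carries the remaining digits, so induction on their number applies.\<close>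

lemma base_expansion_inj:
  fixes d e :: "nat \<Rightarrow> nat"
  assumes "(\<Sum>i<m. d i * B ^ i) = (\<Sum>i<m. e i * B ^ i)" "\<forall>i<m. d i < B \<and> e i < B" "j < m"
  shows "d j = e j"
  using assms
proof (induction m arbitrary: d e j)
  case (Suc m)
  define D E where "D = (\<Sum>i<m. d (Suc i) * B ^ i)" and "E = (\<Sum>i<m. e (Suc i) * B ^ i)"
  have "d 0 + B * D = e 0 + B * E"
    using Suc.prems(1) unfolding D_def E_def
    by (simp add: sum.lessThan_Suc_shift sum_distrib_left algebra_simps del: sum.lessThan_Suc)
  moreover have "d 0 < B" "e 0 < B"
    using Suc.prems(2) by auto
  moreover have "d 0 = (d 0 + B * D) mod B" "e 0 = (e 0 + B * E) mod B"
    using calculation(2,3) by auto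
  moreover have "D = (d 0 + B * D) div B" "E = (e 0 + B * E) div B"
    using calculation(2,3) by auto
  ultimately have "d 0 = e 0" "D = E" by simp_all
  then show ?case
    using Suc.IH[of "\<lambda>i. d (Suc i)" "\<lambda>i. e (Suc i)" "j - 1"] Suc.prems(2,3)
    by (cases j) (auto simp: D_def E_def)
qed simp

text \<open>Kronecker substitution \<open>x\<^sub>i = z ^ (B ^ i)\<close> with \<open>B\<close> above all exponents of \<open>f\<close> keeps
  the monomials of \<open>f\<close> apart.\<close>

lemma meval_eq_0_imp_eq_0:
  fixes f :: "('n::finite, 'k::field) mpol"
  assumes inf: "infinite (UNIV :: 'k set)" and zero: "\<And>v. meval f v = 0"
  shows "f = 0"
proof -
  obtain \<iota> :: "nat \<Rightarrow> 'n" where \<iota>: "bij_betw \<iota> {..<CARD('n)} UNIV"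
    using ex_bij_betw_nat_finite[of "UNIV :: 'n set"] by (auto simp: atLeast0LessThan)
  define w where "w i = the_inv_into {..<CARD('n)} \<iota> i" for i
  \<comment> \<open>The inserted 0 keeps the maximum meaningful for f = 0; \<open>Suc\<close> makes
    all exponents genuine base-\<open>B\<close> digits.\<close>
  define B where "B = Suc (Max (insert 0 ((\<lambda>(a, i). Poly_Mapping.lookup a i) ` (Poly_Mapping.keys f \<times> UNIV))))"
  have B: "Poly_Mapping.lookup a i < B" if "a \<in> Poly_Mapping.keys f" for a i
    unfolding B_def using that by (intro le_imp_less_Suc Max_ge) auto
  define e where "e a = (\<Sum>i\<in>UNIV. B ^ w i * Poly_Mapping.lookup a i)" for a :: "'n \<Rightarrow>\<^sub>0 nat"
  have e_eq: "e a = (\<Sum>i<CARD('n). Poly_Mapping.lookup a (\<iota> i) * B ^ i)" for a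
    unfolding e_def using \<iota>
    by (subst sum.reindex_bij_betw[OF \<iota>, symmetric])
      (auto simp: w_def the_inv_into_f_f bij_betw_def mult.commute intro!: sum.cong)
  have inj: "inj_on e (Poly_Mapping.keys f)"
  proof (rule inj_onI, rule poly_mapping_eqI)
    fix a b i assume ab: "a \<in> Poly_Mapping.keys f" "b \<in> Poly_Mapping.keys f" "e a = e b"
    obtain j where j: "j < CARD('n)" "i = \<iota> j"
      using \<iota> by (auto simp: bij_betw_def image_iff)
    show "Poly_Mapping.lookup a i = Poly_Mapping.lookup b i"
      using base_expansion_inj[of "\<lambda>j. Poly_Mapping.lookup a (\<iota> j)" B "CARD('n)" "\<lambda>j. Poly_Mapping.lookup b (\<iota> j)" j]
        ab B j by (simp add: e_eq)
  qed
  \<comment> \<open>Restricting f to the curve gives this univariate polynomial. Infinitely many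
    roots make it 0, and by injectivity of \<open>e\<close> its coefficients are those of f.\<close>
  define p where "p = (\<Sum>a\<in>Poly_Mapping.keys f. Polynomial.monom (Poly_Mapping.lookup f a) (e a))"
  have "poly p z = meval f (\<chi> i. z ^ (B ^ w i))" for z
    by (simp add: p_def poly_sum poly_monom meval_def e_def power_sum power_mult)
  then have "{z. poly p z = 0} = UNIV"
    using zero by simp
  then have "p = 0"
    using poly_roots_finite[of p] inf by auto
  have "Poly_Mapping.lookup f b = 0" if b: "b \<in> Poly_Mapping.keys f" for b
  proof -
    have "Polynomial.coeff p (e b) = (\<Sum>a\<in>Poly_Mapping.keys f. if a = b then Poly_Mapping.lookup f a else 0)"
      unfolding p_def coeff_sum using inj b by (intro sum.cong) (auto simp: inj_on_def)
    then show ?thesis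
      using b \<open>p = 0\<close> by simp
  qed
  then show ?thesis
    by (intro poly_mapping_eqI) (metis in_keys_iff lookup_zero)
qed

text \<open>Suited to kernels cut out by equations of the forms x_i = 0 and x_i = x_j that hold
  modulo \<open>P\<close>. Substituting class representatives for the variables changes f only
  modulo \<open>P\<close> and lands in \<open>V\<close>, so the result vanishes everywhere and is 0
  because the field is infinite.\<close>

lemma vanishing_ideal_subset:
  fixes P :: "('n::finite, 'k::field) mpol set" and V :: "('k ^ 'n) set"
  assumes inf: "infinite (UNIV :: 'k set)" and P: "comm_prime_ideal P"
    and V: "\<And>v :: 'k ^ 'n. \<lbrakk>\<And>i. mvar i \<in> P \<Longrightarrow> v $ i = 0;
      \<And>i j. mvar i - mvar j \<in> P \<Longrightarrow> v $ i = v $ j\<rbrakk> \<Longrightarrow> v \<in> V"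
  shows "vanishing_ideal V \<subseteq> P"
proof
  interpret comm_prime_ideal P by (rule P)
  \<comment> \<open>The choice depends only on the congruence class, so congruent variables share
    their representative.\<close>
  define rep :: "'n \<Rightarrow> 'n" where "rep j = (SOME i. mvar i \<doteq> mvar j)" for j
  have rep: "mvar (rep j) \<doteq> mvar j" for j
    unfolding rep_def by (rule someI[of _ j]) simp
  have rep_eq: "rep i = rep j" if "mvar i \<doteq> mvar j" for i j
  proof -
    have "(\<lambda>l. mvar l \<doteq> mvar i) = (\<lambda>l. mvar l \<doteq> mvar j)"
      using that eqmod_trans eqmod_sym by blast
    then show ?thesis by (simp add: rep_def)
  qed
  define h :: "'n \<Rightarrow> ('n, 'k) mpol" where "h j = (if mvar j \<in> P then 0 else mvar (rep j))" for j
  have h: "mvar j \<doteq> h j" for j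
    unfolding h_def using rep[of j] eqmod_sym by (auto simp: eqmod_0)
  have in_V: "(\<chi> j. meval (h j) v) \<in> V" for v
  proof (rule V)
    fix i j :: 'n assume "mvar i - mvar j \<in> P"
    then have "mvar i \<doteq> mvar j" by (simp add: eqmod_def)
    then have "h i = h j" using rep_eq eqmod_mem unfolding h_def by metis
    then show "(\<chi> j. meval (h j) v) $ i = (\<chi> j. meval (h j) v) $ j" by simp
  qed (simp add: h_def)
  fix f assume f: "f \<in> vanishing_ideal V"
  define fh where "fh = (\<Sum>a\<in>Poly_Mapping.keys f.
    mconst (Poly_Mapping.lookup f a) * (\<Prod>i\<in>UNIV. h i ^ Poly_Mapping.lookup a i))"
  have "meval fh v = meval f (\<chi> j. meval (h j) v)" for v
    unfolding fh_def meval_sum meval_mult meval_prod meval_power by (simp add: meval_def[of f])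
  then have "fh = 0"
    using f in_V by (intro meval_eq_0_imp_eq_0[OF inf]) (simp add: vanishing_ideal_def)
  moreover have "f \<doteq> fh"
    by (subst mpol_expansion[of f], unfold fh_def)
      (intro eqmod_sum eqmod_mult eqmod_prod eqmod_power eqmod_refl h)
  ultimately show "f \<in> P" by (simp add: eqmod_0)
qed

section \<open>Chains of primes and linear independence\<close>

text \<open>Gaussian elimination: an equation with a nonzero coefficient is solved for the unknown
  \<open>j0\<close>, which is then substituted into the others. Equations and unknowns both decrease
  by one.\<close>

lemma homogeneous_system_nontrivial_solution:
  fixes c :: "'j \<Rightarrow> 'b \<Rightarrow> 'k::field"
  assumes "finite B" "finite J" "card B < card J"
  obtains d where "\<exists>j\<in>J. d j \<noteq> 0" "\<And>b. b \<in> B \<Longrightarrow> (\<Sum>j\<in>J. d j * c j b) = 0"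
  using assms
proof (induction B arbitrary: J c thesis rule: finite_induct)
  case empty
  then obtain j where "j \<in> J" by fastforce
  then show ?case using empty(1)[of "\<lambda>_. 1"] by auto
next
  case (insert b B)
  show ?case
  proof (cases "\<forall>j\<in>J. c j b = 0")
    case True
    obtain d where "\<exists>j\<in>J. d j \<noteq> 0" "\<And>b. b \<in> B \<Longrightarrow> (\<Sum>j\<in>J. d j * c j b) = 0"
      by (rule insert.IH[of J c]) (use insert in auto)
    then show ?thesis using True by (intro insert.prems(1)[of d]) auto
  next
    case False
    then obtain j0 where j0: "j0 \<in> J" "c j0 b \<noteq> 0" by blast
    define J' where "J' = J - {j0}"
    have J: "J = insert j0 J'" "j0 \<notin> J'" "finite J'" "card B < card J'"
      using j0 insert by (auto simp: J'_def)
    obtain d where d: "\<exists>j\<in>J'. d j \<noteq> 0"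
      "\<And>u. u \<in> B \<Longrightarrow> (\<Sum>j\<in>J'. d j * (c j u - c j b / c j0 b * c j0 u)) = 0"
      using insert.IH[of J' "\<lambda>j u. c j u - c j b / c j0 b * c j0 u"] J by blast
    \<comment> \<open>Back substitution: this value of the eliminated unknown makes equation
      \<open>b\<close> hold.\<close>
    define d' where "d' = d(j0 := - (\<Sum>j\<in>J'. d j * c j b) / c j0 b)"
    have "(\<Sum>j\<in>J. d' j * c j u) = (\<Sum>j\<in>J'. d j * (c j u - c j b / c j0 b * c j0 u))" for u
    proof -
      have "(\<Sum>j\<in>J'. d' j * c j u) = (\<Sum>j\<in>J'. d j * c j u)"
        using J(2) by (intro sum.cong) (auto simp: d'_def)
      then have "(\<Sum>j\<in>J. d' j * c j u) = - (\<Sum>j\<in>J'. d j * c j b) / c j0 b * c j0 u + (\<Sum>j\<in>J'. d j * c j u)"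
        using J by (simp add: d'_def)
      also have "\<dots> = (\<Sum>j\<in>J'. d j * (c j u - c j b / c j0 b * c j0 u))"
        by (simp add: sum_subtractf algebra_simps sum_distrib_left sum_distrib_right sum_divide_distrib)
      finally show ?thesis .
    qed
    moreover have "(\<Sum>j\<in>J'. d j * (c j b - c j b / c j0 b * c j0 b)) = 0"
      using j0 by simp
    moreover have "\<exists>j\<in>J. d' j \<noteq> 0"
      using d(1) J by (auto simp: d'_def)
    ultimately show ?thesis
      using d(2) by (intro insert.prems(1)[of d']) (auto simp del: times_divide_eq_left)
  qed
qed

section \<open>Independent monomials from a chain of primes\<close>

abbreviation power_product :: "'a::comm_monoid_mult list \<Rightarrow> nat list \<Rightarrow> 'a"
  where "power_product fs es \<equiv> prod_list (map2 (^) fs es)"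

abbreviation exponent_lists :: "nat \<Rightarrow> nat \<Rightarrow> nat list set"
  where "exponent_lists l N \<equiv> {es. set es \<subseteq> {..<N} \<and> length es = l}"

text \<open>Modulo \<open>Q\<close> only the term with e = 0 survives, so \<open>G 0\<close>
  vanishes. The rest is divisible by \<open>f\<close>, which cancels because \<open>P\<close> is
  prime and does not contain it; then induct.\<close>

lemma power_sum_mem_imp_coeffs_eq_0:
  fixes P Q :: "'a::comm_ring_1 set"
  assumes P: "comm_prime_ideal P" and Q: "comm_prime_ideal Q"
    and sub: "P \<subseteq> Q" and f: "f \<in> Q" "f \<notin> P"
    and "\<And>e. e < N \<Longrightarrow> G e \<in> Q \<Longrightarrow> G e = 0"
    and "(\<Sum>e<N. f ^ e * G e) \<in> P" and "e < N"
  shows "G e = 0"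
  using assms(6-)
proof (induction N arbitrary: G e)
  case (Suc N)
  interpret P: comm_prime_ideal P by (rule P)
  interpret Q: comm_prime_ideal Q by (rule Q)
  define T where "T = (\<Sum>e<N. f ^ e * G (Suc e))"
  have sum: "(\<Sum>e<Suc N. f ^ e * G e) = G 0 + f * T"
    unfolding T_def sum.lessThan_Suc_shift by (simp add: sum_distrib_left mult.assoc)
  then have "G 0 + f * T \<in> Q"
    using Suc.prems(2) sub by auto
  then have "G 0 \<in> Q"
    using Q.diff_mem[of "G 0 + f * T" "f * T"] Q.mult_mem'[OF f(1)] by simp
  then have 0: "G 0 = 0"
    using Suc.prems(1)[of 0] by simp
  then have "T \<in> P"
    using P.prime_mem[of f T] f(2) sum Suc.prems(2) by simp
  then have "G (Suc e) = 0" if "e < N" for e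
    using Suc.IH[of "\<lambda>e. G (Suc e)" e] Suc.prems(1) that by (simp add: T_def)
  then show ?case
    using 0 Suc.prems(3) by (cases e) auto
qed simp

lemma finite_exponent_lists: "finite (exponent_lists l N)"
  using finite_lists_length_eq[of "{..<N}" l] by simp

lemma sum_exponent_lists_Suc:
  "(\<Sum>es\<in>exponent_lists (Suc l) N. h es) = (\<Sum>e<N. \<Sum>es\<in>exponent_lists l N. h (e # es))"
proof -
  have "bij_betw (\<lambda>(e, es). e # es) ({..<N} \<times> exponent_lists l N) (exponent_lists (Suc l) N)"
    by (rule bij_betwI[of _ _ _ "\<lambda>es. (hd es, tl es)"]) (auto simp: length_Suc_conv)
  then show ?thesis
    unfolding sum.cartesian_product
    by (subst sum.reindex_bij_betw[symmetric]) (auto intro!: sum.cong)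
qed

text \<open>If \<open>f\<^sub>i\<close> lies in \<open>Q\<^sub>i\<close> but not in \<open>Q\<^sub>i\<^sub>-\<^sub>1\<close>, then the monomials in the \<open>f\<^sub>i\<close> are linearly
  independent modulo \<open>Q\<^sub>0\<close>.\<close>

lemma prime_chain_independent_monomials:
  fixes Q :: "nat \<Rightarrow> ('n::finite, 'k::field) mpol set"
  assumes "\<And>i. i \<le> l \<Longrightarrow> comm_prime_ideal (Q i)" "\<And>i. i < l \<Longrightarrow> Q i \<subset> Q (Suc i)"
  obtains fs where "length fs = l"
    "\<And>N c es. \<lbrakk>(\<Sum>es\<in>exponent_lists l N. mconst (c es) * power_product fs es) \<in> Q 0;
       es \<in> exponent_lists l N\<rbrakk> \<Longrightarrow> c es = 0"
  using assms
proof (induction l arbitrary: Q thesis)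
  case 0
  interpret comm_prime_ideal "Q 0" using 0 by simp
  \<comment> \<open>A nonzero constant is a unit and cannot lie in a prime ideal.\<close>
  have "c [] = 0" if "mconst (c []) \<in> Q 0" for c :: "nat list \<Rightarrow> 'k"
  proof (rule ccontr)
    assume "c [] \<noteq> 0"
    then have "mconst (inverse (c [])) * mconst (c []) = (1 :: ('n, 'k) mpol)"
      by (simp flip: mconst_mult)
    then show False
      using mult_mem[OF that, of "mconst (inverse (c []))"] one_not_mem by simp
  qed
  moreover have "exponent_lists 0 N = {[]}" for N by auto
  ultimately show ?case using 0(1)[of "[]"] by auto
next
  case (Suc l)
  obtain fs where fs: "length fs = l"
    "\<And>N c es. \<lbrakk>(\<Sum>es\<in>exponent_lists l N. mconst (c es) * power_product fs es) \<in> Q 1;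
       es \<in> exponent_lists l N\<rbrakk> \<Longrightarrow> c es = 0"
    by (rule Suc.IH[of "\<lambda>i. Q (Suc i)"]) (use Suc.prems in auto)
  obtain f where f: "f \<in> Q 1" "f \<notin> Q 0"
    using Suc.prems(3)[of 0] by auto
  show ?case
  proof (rule Suc.prems(1)[of "f # fs"])
    show "length (f # fs) = Suc l" using fs by simp
    fix N c es
    assume sum: "(\<Sum>es\<in>exponent_lists (Suc l) N. mconst (c es) * power_product (f # fs) es) \<in> Q 0"
      and es: "es \<in> exponent_lists (Suc l) N"
    \<comment> \<open>Sorting by the exponent of \<open>f\<close> leaves coefficients in the later
      elements only, to which the independence modulo \<open>Q 1\<close> applies.\<close>
    define G where "G e = (\<Sum>es\<in>exponent_lists l N. mconst (c (e # es)) * power_product fs es)" for e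
    have c0: "c (e # es) = 0" if "G e \<in> Q 1" "es \<in> exponent_lists l N" for e es
      by (rule fs(2)[of "\<lambda>es. c (e # es)" N]) (use that in \<open>auto simp: G_def\<close>)
    have "(\<Sum>e<N. f ^ e * G e) \<in> Q 0"
      using sum unfolding sum_exponent_lists_Suc by (simp add: G_def sum_distrib_left ac_simps)
    then have G0: "G e = 0" if "e < N" for e
      using power_sum_mem_imp_coeffs_eq_0[of "Q 0" "Q 1" f N G e] Suc.prems(2)[of 0]
        Suc.prems(2)[of 1] Suc.prems(3)[of 0] f that c0 by (auto simp: G_def)
    obtain e es' where "es = e # es'" "e < N" "es' \<in> exponent_lists l N"
      using es by (auto simp: length_Suc_conv)
    \<comment> \<open>\<open>G e\<close> is 0 as a polynomial; seen as an element of
      \<open>Q 1\<close>, it lets \<open>c0\<close> pass to its coefficients.\<close>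
    moreover have "0 \<in> Q 1"
      using comm_prime_ideal.zero_mem Suc.prems(2)[of 1] by auto
    ultimately show "c es = 0"
      using c0[of e es'] G0[of e] by simp
  qed
qed

section \<open>Exponent bounds and growth\<close>

definition exps_le :: "nat \<Rightarrow> ('n::finite, 'k::field) mpol \<Rightarrow> bool" where
  "exps_le M f \<longleftrightarrow> (\<forall>a\<in>Poly_Mapping.keys f. \<forall>i. Poly_Mapping.lookup a i \<le> M)"

lemma exps_le_mono: "exps_le M f \<Longrightarrow> M \<le> M' \<Longrightarrow> exps_le M' f"
  unfolding exps_le_def by (meson le_trans)

lemma exps_le_mult:
  assumes "exps_le M f" "exps_le M' g"
  shows "exps_le (M + M') (f * g)"
  using keys_mult[of f g] assms unfolding exps_le_def
  by (fastforce simp: lookup_add intro: add_mono)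

lemma exps_le_power: "exps_le M f \<Longrightarrow> exps_le (e * M) (f ^ e)"
  by (induction e) (auto intro: exps_le_mult simp: exps_le_def[of 0])

lemma exps_le_exists: "\<exists>M. exps_le M f"
proof -
  let ?A = "(\<lambda>(a, i). Poly_Mapping.lookup a i) ` (Poly_Mapping.keys f \<times> UNIV)"
  have "exps_le (Max ?A) f"
    unfolding exps_le_def by (auto intro!: Max_ge)
  then show ?thesis by blast
qed

text \<open>The bound is linear in \<open>N\<close>: each factor contributes its own exponent bound
  fewer than \<open>N\<close> times, and \<open>D\<close> sums these bounds.\<close>

lemma exps_le_power_product:
  "\<exists>D. \<forall>N. \<forall>es\<in>exponent_lists (length fs) N. exps_le (N * D) (power_product fs es)"
proof (induction fs)
  case Nil
  then show ?case by (auto simp: exps_le_def)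
next
  case (Cons f fs)
  then obtain D where D: "\<And>N es. es \<in> exponent_lists (length fs) N \<Longrightarrow> exps_le (N * D) (power_product fs es)"
    by blast
  obtain M where M: "exps_le M f" using exps_le_exists by blast
  have "exps_le (N * (M + D)) (power_product (f # fs) es)"
    if es: "es \<in> exponent_lists (length (f # fs)) N" for N es
  proof -
    obtain e es' where e: "es = e # es'" "e < N" "es' \<in> exponent_lists (length fs) N"
      using es by (auto simp: length_Suc_conv)
    have "exps_le (e * M + N * D) (power_product (f # fs) es)"
      using exps_le_mult[OF exps_le_power[OF M] D[OF e(3)]] e(1) by simp
    then show ?thesis
      by (rule exps_le_mono) (use e(2) in \<open>auto simp: distrib_left\<close>)
  qed
  then show ?case by blast
qed

section \<open>Comparing growth rates\<close>

text \<open>Taking N = C + 1 already refutes l > d.\<close>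

lemma le_of_power_le_mult_power:
  fixes C :: nat
  assumes "\<And>N. N \<ge> 1 \<Longrightarrow> N ^ l \<le> C * N ^ d"
  shows "l \<le> d"
proof (rule ccontr)
  assume "\<not> l \<le> d"
  then have "Suc C ^ Suc d \<le> Suc C ^ l"
    by (intro power_increasing) auto
  also have "\<dots> \<le> C * Suc C ^ d"
    by (rule assms) simp
  finally show False by simp
qed

text \<open>After multiplication by \<open>g\<close>, a common denominator, all \<open>G j\<close>
  lie in the span of \<open>B\<close> modulo \<open>P\<close>. More of them than elements of
  \<open>B\<close> would be dependent, and \<open>g\<close> cancels from the dependency by
  primality. The extra 0 absorbs monomials that lie in \<open>P\<close>.\<close>

lemma card_independent_le_card_spanning:
  fixes P :: "('n::finite, 'k::field) mpol set" and G :: "'j \<Rightarrow> ('n, 'k) mpol"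
  assumes P: "comm_prime_ideal P" and J: "finite J"
    and indep: "\<And>c j. (\<Sum>j\<in>J. mconst (c j) * G j) \<in> P \<Longrightarrow> j \<in> J \<Longrightarrow> c j = 0"
    and exps: "\<And>j. j \<in> J \<Longrightarrow> exps_le M (G j)"
    and g: "g \<notin> P" and B: "finite B"
    and monoms: "\<And>a. (\<And>i. Poly_Mapping.lookup a i \<le> M) \<Longrightarrow> \<exists>u\<in>insert 0 B. g * mmonom a - u \<in> P"
  shows "card J \<le> card B"
proof (rule ccontr)
  assume "\<not> ?thesis"
  then have less: "card B < card J" by simp
  interpret comm_prime_ideal P by (rule P)
  obtain U where U: "\<And>a. (\<And>i. Poly_Mapping.lookup a i \<le> M) \<Longrightarrow> U a \<in> insert 0 B \<and> g * mmonom a \<doteq> U a"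
    using monoms unfolding eqmod_def by metis
  have "\<exists>c. g * f \<doteq> (\<Sum>u\<in>B. mconst (c u) * u)" if f: "exps_le M f" for f
  proof -
    let ?K = "Poly_Mapping.keys f" and ?c = "Poly_Mapping.lookup f"
    \<comment> \<open>Monomials with the same image \<open>u\<close> pool their
      coefficients.\<close>
    define c where "c u = (\<Sum>a\<in>{a \<in> ?K. U a = u}. ?c a)" for u
    have Ua: "U a \<in> insert 0 B" "g * mmonom a \<doteq> U a" if "a \<in> ?K" for a
      using U f that unfolding exps_le_def by blast+
    have "g * f = (\<Sum>a\<in>?K. mconst (?c a) * (g * mmonom a))"
      using arg_cong[OF mpol_expansion[of f], of "(*) g"] by (simp add: sum_distrib_left ac_simps)
    also have "\<dots> \<doteq> (\<Sum>a\<in>?K. mconst (?c a) * U a)"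
      by (intro eqmod_sum eqmod_mult eqmod_refl Ua)
    also have "(\<Sum>a\<in>?K. mconst (?c a) * U a)
        = (\<Sum>u\<in>insert 0 B. \<Sum>a\<in>{a \<in> ?K. U a = u}. mconst (?c a) * U a)"
      using Ua B by (intro sum.group[symmetric]) auto
    also have "\<dots> = (\<Sum>u\<in>insert 0 B. mconst (c u) * u)"
      by (intro sum.cong refl) (auto simp: c_def mconst_sum sum_distrib_right intro!: sum.cong)
    also have "\<dots> = (\<Sum>u\<in>B. mconst (c u) * u)"
      using B by (intro sum.mono_neutral_right) auto
    finally show ?thesis by blast
  qed
  then have "\<forall>j\<in>J. \<exists>c. g * G j \<doteq> (\<Sum>u\<in>B. mconst (c u) * u)"
    using exps by blast
  from bchoice[OF this] obtain c where c: "\<And>j. j \<in> J \<Longrightarrow> g * G j \<doteq> (\<Sum>u\<in>B. mconst (c j u) * u)"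
    by blast
  obtain d where d: "\<exists>j\<in>J. d j \<noteq> 0" "\<And>u. u \<in> B \<Longrightarrow> (\<Sum>j\<in>J. d j * c j u) = 0"
    by (rule homogeneous_system_nontrivial_solution[OF B J less, of c], rule that, assumption, blast)
  have "g * (\<Sum>j\<in>J. mconst (d j) * G j) = (\<Sum>j\<in>J. mconst (d j) * (g * G j))"
    by (simp add: sum_distrib_left ac_simps)
  also have "\<dots> \<doteq> (\<Sum>j\<in>J. mconst (d j) * (\<Sum>u\<in>B. mconst (c j u) * u))"
    by (intro eqmod_sum eqmod_mult eqmod_refl c)
  also have "\<dots> = (\<Sum>u\<in>B. mconst (\<Sum>j\<in>J. d j * c j u) * u)"
    unfolding mconst_sum mconst_mult sum_distrib_left sum_distrib_right mult.assoc
    by (rule sum.swap)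
  also have "\<dots> = 0"
    using d(2) by simp
  finally have "(\<Sum>j\<in>J. mconst (d j) * G j) \<in> P"
    using g prime_mem unfolding eqmod_0 by blast
  then show False using indep[of d] d(1) by blast
qed

text \<open>The chain supplies \<open>N ^ l\<close> independent polynomials with exponents linear in
  \<open>N\<close>, and the spanning sets have O(\<open>N ^ d\<close>) elements.\<close>

lemma prime_chain_length_le_growth:
  fixes Q :: "nat \<Rightarrow> ('n::finite, 'k::field) mpol set"
  assumes chain: "\<And>i. i \<le> l \<Longrightarrow> comm_prime_ideal (Q i)" "\<And>i. i < l \<Longrightarrow> Q i \<subset> Q (Suc i)"
    and growth: "\<And>M. M \<ge> 1 \<Longrightarrow> \<exists>g B. g \<notin> Q 0 \<and> finite B \<and> card B \<le> C * M ^ d \<and>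
      (\<forall>a. (\<forall>i. Poly_Mapping.lookup a i \<le> M) \<longrightarrow> (\<exists>u\<in>insert 0 B. g * mmonom a - u \<in> Q 0))"
  shows "l \<le> d"
proof -
  obtain fs where fs: "length fs = l"
    "\<And>N c es. \<lbrakk>(\<Sum>es\<in>exponent_lists l N. mconst (c es) * power_product fs es) \<in> Q 0;
       es \<in> exponent_lists l N\<rbrakk> \<Longrightarrow> c es = 0"
    using prime_chain_independent_monomials[of l Q] chain by blast
  obtain D where D: "\<And>N es. es \<in> exponent_lists l N \<Longrightarrow> exps_le (N * D) (power_product fs es)"
    using exps_le_power_product[of fs] fs(1) by blast
  have "N ^ l \<le> C * Suc D ^ d * N ^ d" if N: "N \<ge> 1" for N
  proof -
    \<comment> \<open>\<open>Suc D\<close> keeps \<open>M\<close> positive even if \<open>D\<close>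
      is 0.\<close>
    define M where "M = N * Suc D"
    have "M \<ge> 1" using N by (simp add: M_def)
    then obtain g B where g: "g \<notin> Q 0" and B: "finite B" "card B \<le> C * M ^ d"
      and monoms: "\<And>a. (\<And>i. Poly_Mapping.lookup a i \<le> M) \<Longrightarrow> \<exists>u\<in>insert 0 B. g * mmonom a - u \<in> Q 0"
      using growth[of M] by blast
    have "exps_le M (power_product fs es)" if "es \<in> exponent_lists l N" for es
      using exps_le_mono[OF D[OF that], of M] by (simp add: M_def)
    then have "card (exponent_lists l N) \<le> card B"
      using chain(1)[of 0] fs(2) g B(1) monoms finite_exponent_lists
      by (intro card_independent_le_card_spanning[of "Q 0" _ "power_product fs" M g]) auto
    then have "N ^ l \<le> C * M ^ d"
      using B(2) card_lists_length_eq[of "{..<N}" l] by simp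
    then show ?thesis
      by (simp only: M_def power_mult_distrib ac_simps)
  qed
  then show ?thesis
    by (rule le_of_power_le_mult_power)
qed

section \<open>Normal forms of monomials modulo a prime\<close>

text \<open>Each variable outside \<open>P\<close> is a power of a/b times a generator, so a
  monomial is (a/b)^w times a monomial in the generators. The denominator is padded to
  \<open>b ^ (M * \<tau>)\<close>, which depends on \<open>M\<close> alone and can serve all
  monomials in the box.\<close>

lemma monom_eqmod_generators:
  fixes P :: "('n::finite, 'k::field) mpol set"
  assumes P: "comm_prime_ideal P"
    and gen: "\<And>j. mvar j \<notin> P \<Longrightarrow> \<exists>s\<in>S. \<exists>t. b ^ t * mvar j - a ^ t * mvar s \<in> P"
  obtains \<tau> where "\<And>M \<alpha>. \<lbrakk>\<And>i. Poly_Mapping.lookup \<alpha> i \<le> M; mmonom \<alpha> \<notin> P\<rbrakk> \<Longrightarrow>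
    \<exists>w\<le>M * \<tau>. \<exists>\<gamma>\<in>S \<rightarrow>\<^sub>E {..CARD('n) * M}.
      b ^ (M * \<tau>) * mmonom \<alpha> - b ^ (M * \<tau> - w) * a ^ w * (\<Prod>s\<in>S. mvar s ^ \<gamma> s) \<in> P"
proof -
  interpret comm_prime_ideal P by (rule P)
  define N where "N = {j :: 'n. mvar j \<notin> P}"
  have "\<forall>j\<in>N. \<exists>s t. s \<in> S \<and> b ^ t * mvar j \<doteq> a ^ t * mvar s"
    using gen unfolding eqmod_def N_def by blast
  then obtain \<sigma> t where gen': "\<And>j. j \<in> N \<Longrightarrow> \<sigma> j \<in> S \<and> b ^ t j * mvar j \<doteq> a ^ t j * mvar (\<sigma> j)"
    by metis
  define \<tau> where "\<tau> = (\<Sum>j\<in>N. t j)"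
  show ?thesis
  proof (rule that[of \<tau>])
    fix M \<alpha> assume \<alpha>: "\<And>i. Poly_Mapping.lookup \<alpha> i \<le> M" and notin: "mmonom \<alpha> \<notin> P"
    let ?e = "Poly_Mapping.lookup \<alpha>"
    \<comment> \<open>A monomial outside \<open>P\<close> contains no variable from
      \<open>P\<close>.\<close>
    have e0: "?e j = 0" if "j \<notin> N" for j
    proof (rule ccontr)
      assume "?e j \<noteq> 0"
      then have "mvar j ^ ?e j \<in> P"
        using that by (simp add: N_def power_mem_iff)
      then have "mvar j ^ ?e j * (\<Prod>i\<in>UNIV - {j}. mvar i ^ ?e i) \<in> P"
        by (rule mult_mem')
      then show False
        using notin prod.remove[of UNIV j "\<lambda>i. mvar i ^ ?e i :: ('n, 'k) mpol"] by simp
    qed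
    define w where "w = (\<Sum>j\<in>N. t j * ?e j)"
    have "w \<le> (\<Sum>j\<in>N. t j * M)"
      unfolding w_def using \<alpha> by (intro sum_mono mult_left_mono) auto
    then have w: "w \<le> M * \<tau>"
      by (simp add: \<tau>_def sum_distrib_left mult.commute)
    \<comment> \<open>Exponents of variables with the same generator add up; the restriction to
      \<open>S\<close> makes the exponent functions countable by \<open>card_PiE\<close>.\<close>
    define \<gamma> where "\<gamma> = (\<lambda>s\<in>S. \<Sum>j | j \<in> N \<and> \<sigma> j = s. ?e j)"
    have "\<gamma> s \<le> CARD('n) * M" if "s \<in> S" for s
    proof -
      have "\<gamma> s \<le> (\<Sum>j | j \<in> N \<and> \<sigma> j = s. M)"
        unfolding \<gamma>_def using \<alpha> that by (simp add: sum_mono del: sum_constant)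
      also have "\<dots> \<le> CARD('n) * M"
        by (simp add: card_mono)
      finally show ?thesis .
    qed
    then have \<gamma>: "\<gamma> \<in> S \<rightarrow>\<^sub>E {..CARD('n) * M}"
      by (auto simp: \<gamma>_def)
    have "b ^ w * mmonom \<alpha> = b ^ w * (\<Prod>j\<in>N. mvar j ^ ?e j)"
      using e0 by (intro arg_cong2[of _ _ _ _ "(*)"] prod.mono_neutral_right refl) auto
    also have "\<dots> = (\<Prod>j\<in>N. (b ^ t j * mvar j) ^ ?e j)"
      by (simp add: w_def power_sum power_mult power_mult_distrib prod.distrib)
    also have "\<dots> \<doteq> (\<Prod>j\<in>N. (a ^ t j * mvar (\<sigma> j)) ^ ?e j)"
      by (intro eqmod_prod eqmod_power) (use gen' in blast)
    also have "(\<Prod>j\<in>N. (a ^ t j * mvar (\<sigma> j)) ^ ?e j) = a ^ w * (\<Prod>j\<in>N. mvar (\<sigma> j) ^ ?e j)"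
      by (simp add: w_def power_sum power_mult power_mult_distrib prod.distrib)
    also have "(\<Prod>j\<in>N. mvar (\<sigma> j) ^ ?e j) = (\<Prod>s\<in>S. \<Prod>j | j \<in> N \<and> \<sigma> j = s. mvar (\<sigma> j) ^ ?e j)"
      using gen' by (intro prod.group[symmetric]) auto
    also have "\<dots> = (\<Prod>s\<in>S. mvar s ^ \<gamma> s)"
      by (intro prod.cong refl) (auto simp: \<gamma>_def power_sum intro!: prod.cong)
    finally have "b ^ (M * \<tau> - w) * (b ^ w * mmonom \<alpha>) \<doteq> b ^ (M * \<tau> - w) * (a ^ w * (\<Prod>s\<in>S. mvar s ^ \<gamma> s))"
      by (rule eqmod_mult[OF eqmod_refl])
    moreover have "b ^ (M * \<tau> - w) * b ^ w = b ^ (M * \<tau>)"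
      using w by (simp flip: power_add)
    ultimately have "b ^ (M * \<tau>) * mmonom \<alpha> \<doteq> b ^ (M * \<tau> - w) * a ^ w * (\<Prod>s\<in>S. mvar s ^ \<gamma> s)"
      by (simp add: mult.assoc[symmetric])
    then show "\<exists>w\<le>M * \<tau>. \<exists>\<gamma>\<in>S \<rightarrow>\<^sub>E {..CARD('n) * M}.
        b ^ (M * \<tau>) * mmonom \<alpha> - b ^ (M * \<tau> - w) * a ^ w * (\<Prod>s\<in>S. mvar s ^ \<gamma> s) \<in> P"
      using w \<gamma> unfolding eqmod_def by blast
  qed
qed

text \<open>If a/b is a c-th root of unity modulo \<open>P\<close>, only the residue of its exponent
  modulo \<open>c\<close> matters.\<close>

lemma power_ratio_mod:
  fixes P :: "'a::comm_ring_1 set"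
  assumes P: "comm_prime_ideal P" and c: "a ^ c - b ^ c \<in> P" and w: "w \<le> T"
  shows "b ^ (T - w) * a ^ w - b ^ (T - w mod c) * a ^ (w mod c) \<in> P"
proof -
  interpret comm_prime_ideal P by (rule P)
  have "b ^ (T - w) * a ^ w = b ^ (T - w) * a ^ (w mod c) * (a ^ c) ^ (w div c)"
    by (simp add: mult.assoc flip: power_mult power_add)
  also have "\<dots> \<doteq> b ^ (T - w) * a ^ (w mod c) * (b ^ c) ^ (w div c)"
    using c by (intro eqmod_mult[OF eqmod_refl] eqmod_power[of "a ^ c"]) (simp add: eqmod_def)
  also have "\<dots> = b ^ (T - w + c * (w div c)) * a ^ (w mod c)"
    by (simp add: power_add power_mult ac_simps)
  also have "T - w + c * (w div c) = T - w mod c"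
    using w minus_mod_eq_mult_div[of w c] mod_less_eq_dividend[of w c] by linarith
  finally show ?thesis by (simp add: eqmod_def)
qed

lemma card_generated_elements:
  assumes "finite W" "finite S"
  shows "card ((\<lambda>(w, \<gamma>). h w \<gamma>) ` (W \<times> (S \<rightarrow>\<^sub>E {..K::nat}))) \<le> card W * Suc K ^ card S"
proof -
  have "card ((\<lambda>(w, \<gamma>). h w \<gamma>) ` (W \<times> (S \<rightarrow>\<^sub>E {..K}))) \<le> card (W \<times> (S \<rightarrow>\<^sub>E {..K}))"
    using assms by (intro card_image_le finite_cartesian_product finite_PiE) auto
  then show ?thesis
    using assms by (simp add: card_cartesian_product card_PiE)
qed

text \<open>The exponent of a/b takes O(\<open>M\<close>) values in general, which costs one extra
  factor \<open>M\<close>; for a root of unity it takes only \<open>c\<close> values.\<close>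

lemma prime_chain_length_le_generators:
  fixes Q :: "nat \<Rightarrow> ('n::finite, 'k::field) mpol set"
  assumes chain: "\<And>i. i \<le> l \<Longrightarrow> comm_prime_ideal (Q i)" "\<And>i. i < l \<Longrightarrow> Q i \<subset> Q (Suc i)"
    and b: "b \<notin> Q 0"
    and gen: "\<And>j. mvar j \<notin> Q 0 \<Longrightarrow> \<exists>s\<in>S. \<exists>t. b ^ t * mvar j - a ^ t * mvar s \<in> Q 0"
  shows "l \<le> card S + 1" and "c > 0 \<Longrightarrow> a ^ c - b ^ c \<in> Q 0 \<Longrightarrow> l \<le> card S"
proof -
  have P: "comm_prime_ideal (Q 0)" using chain by simp
  interpret comm_prime_ideal "Q 0" by (rule P)
  let ?m = "CARD('n)"
  obtain \<tau> where \<tau>: "\<And>M \<alpha>. \<lbrakk>\<And>i. Poly_Mapping.lookup \<alpha> i \<le> M; mmonom \<alpha> \<notin> Q 0\<rbrakk> \<Longrightarrow>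
    \<exists>w\<le>M * \<tau>. \<exists>\<gamma>\<in>S \<rightarrow>\<^sub>E {..?m * M}.
      b ^ (M * \<tau>) * mmonom \<alpha> - b ^ (M * \<tau> - w) * a ^ w * (\<Prod>s\<in>S. mvar s ^ \<gamma> s) \<in> Q 0"
    using monom_eqmod_generators[OF P gen] by blast
  have b': "b ^ n \<notin> Q 0" for n
    using b by (simp add: power_mem_iff)
  \<comment> \<open>\<open>W\<close> is the range allowed for the exponent of a/b; the two bounds
    differ only in it.\<close>
  define B where "B M W = (\<lambda>(w, \<gamma>). b ^ (M * \<tau> - w) * a ^ w * (\<Prod>s\<in>S. mvar s ^ \<gamma> s)) `
    (W \<times> (S \<rightarrow>\<^sub>E {..?m * M}))" for M W
  have B_fin: "finite (B M W)" if "finite W" for M W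
    unfolding B_def using that by (intro finite_imageI finite_cartesian_product finite_PiE) auto
  have B_card: "card (B M W) \<le> card W * (Suc ?m ^ card S * M ^ card S)"
    if "finite W" "M \<ge> 1" for M W
  proof -
    have "card (B M W) \<le> card W * Suc (?m * M) ^ card S"
      unfolding B_def using that by (intro card_generated_elements) auto
    also have "\<dots> \<le> card W * (Suc ?m * M) ^ card S"
      using that by (intro mult_left_mono power_mono) auto
    finally show ?thesis by (simp only: power_mult_distrib)
  qed
  have zero: "b ^ (M * \<tau>) * f - 0 \<in> Q 0" if "f \<in> Q 0" for f M
    using that mult_mem by simp
  show "l \<le> card S + 1"
  proof (rule prime_chain_length_le_growth[of l Q, OF chain, where C = "Suc \<tau> * Suc ?m ^ card S"])
    fix M :: nat assume M: "M \<ge> 1"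
    have "card (B M {..M * \<tau>}) \<le> Suc (M * \<tau>) * (Suc ?m ^ card S * M ^ card S)"
      using B_card[of "{..M * \<tau>}" M] M by simp
    also have "\<dots> \<le> (M * Suc \<tau>) * (Suc ?m ^ card S * M ^ card S)"
      using M by (intro mult_right_mono) auto
    finally have "card (B M {..M * \<tau>}) \<le> Suc \<tau> * Suc ?m ^ card S * M ^ (card S + 1)"
      by (simp only: power_add power_one_right ac_simps)
    moreover have "\<exists>u\<in>insert 0 (B M {..M * \<tau>}). b ^ (M * \<tau>) * mmonom \<alpha> - u \<in> Q 0"
      if \<alpha>: "\<forall>i. Poly_Mapping.lookup \<alpha> i \<le> M" for \<alpha>
    proof (cases "mmonom \<alpha> \<in> Q 0")
      case False
      then obtain w \<gamma> where "w \<le> M * \<tau>" "\<gamma> \<in> S \<rightarrow>\<^sub>E {..?m * M}"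
        "b ^ (M * \<tau>) * mmonom \<alpha> - b ^ (M * \<tau> - w) * a ^ w * (\<Prod>s\<in>S. mvar s ^ \<gamma> s) \<in> Q 0"
        using \<tau>[of \<alpha> M] \<alpha> by blast
      moreover from this have "b ^ (M * \<tau> - w) * a ^ w * (\<Prod>s\<in>S. mvar s ^ \<gamma> s) \<in> B M {..M * \<tau>}"
        unfolding B_def by (intro image_eqI[of _ _ "(w, \<gamma>)"]) auto
      ultimately show ?thesis by blast
    qed (use zero in blast)
    ultimately show "\<exists>g B. g \<notin> Q 0 \<and> finite B \<and> card B \<le> Suc \<tau> * Suc ?m ^ card S * M ^ (card S + 1) \<and>
      (\<forall>\<alpha>. (\<forall>i. Poly_Mapping.lookup \<alpha> i \<le> M) \<longrightarrow> (\<exists>u\<in>insert 0 B. g * mmonom \<alpha> - u \<in> Q 0))"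
      using b' B_fin[of "{..M * \<tau>}"] by (intro exI[of _ "b ^ (M * \<tau>)"] exI[of _ "B M {..M * \<tau>}"]) auto
  qed
  show "l \<le> card S" if c: "c > 0" "a ^ c - b ^ c \<in> Q 0"
  proof (rule prime_chain_length_le_growth[of l Q, OF chain, where C = "c * Suc ?m ^ card S"])
    fix M :: nat assume M: "M \<ge> 1"
    have "card (B M {..<c}) \<le> c * Suc ?m ^ card S * M ^ card S"
      using B_card[of "{..<c}" M] M by (simp add: mult.assoc)
    moreover have "\<exists>u\<in>insert 0 (B M {..<c}). b ^ (M * \<tau>) * mmonom \<alpha> - u \<in> Q 0"
      if \<alpha>: "\<forall>i. Poly_Mapping.lookup \<alpha> i \<le> M" for \<alpha>
    proof (cases "mmonom \<alpha> \<in> Q 0")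
      case False
      then obtain w \<gamma> where w: "w \<le> M * \<tau>" "\<gamma> \<in> S \<rightarrow>\<^sub>E {..?m * M}"
        and eq: "b ^ (M * \<tau>) * mmonom \<alpha> - b ^ (M * \<tau> - w) * a ^ w * (\<Prod>s\<in>S. mvar s ^ \<gamma> s) \<in> Q 0"
        using \<tau>[of \<alpha> M] \<alpha> by blast
      let ?u = "b ^ (M * \<tau> - w mod c) * a ^ (w mod c) * (\<Prod>s\<in>S. mvar s ^ \<gamma> s)"
      have "eqmod (b ^ (M * \<tau> - w) * a ^ w) (b ^ (M * \<tau> - w mod c) * a ^ (w mod c))"
        using power_ratio_mod[OF P c(2) w(1)] by (simp add: eqmod_def)
      then have "eqmod (b ^ (M * \<tau> - w) * a ^ w * (\<Prod>s\<in>S. mvar s ^ \<gamma> s)) ?u"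
        by (rule eqmod_mult[OF _ eqmod_refl])
      then have "eqmod (b ^ (M * \<tau>) * mmonom \<alpha>) ?u"
        using eqmod_trans[OF eqmod_def[THEN iffD2, OF eq]] by blast
      moreover have "?u \<in> B M {..<c}"
        unfolding B_def using w c(1) by (intro image_eqI[of _ _ "(w mod c, \<gamma>)"]) auto
      ultimately show ?thesis unfolding eqmod_def by blast
    qed (use zero in blast)
    ultimately show "\<exists>g B. g \<notin> Q 0 \<and> finite B \<and> card B \<le> c * Suc ?m ^ card S * M ^ card S \<and>
      (\<forall>\<alpha>. (\<forall>i. Poly_Mapping.lookup \<alpha> i \<le> M) \<longrightarrow> (\<exists>u\<in>insert 0 B. g * mmonom \<alpha> - u \<in> Q 0))"
      using b' B_fin[of "{..<c}"] by (intro exI[of _ "b ^ (M * \<tau>)"] exI[of _ "B M {..<c}"]) auto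
  qed
qed

section \<open>Choosing the generating coordinates\<close>

text \<open>The relations form a graph with an edge from \<open>p\<^sub>2 i\<close> to
  \<open>p\<^sub>1 i\<close>; by injectivity, at most one edge enters and one leaves each
  coordinate. Minimality of \<open>S\<close> restricts the edges meeting \<open>S\<close>, which
  bounds their number by that of the nonzero coordinates outside \<open>S\<close>.\<close>

lemma exists_small_generators:
  fixes P :: "('n::finite, 'k::field) mpol set" and p\<^sub>1 p\<^sub>2 :: "'n \<Rightarrow> 'n"
  assumes P: "comm_prime_ideal P" and inj: "inj p\<^sub>1" "inj p\<^sub>2"
    and a: "a \<notin> P" and b: "b \<notin> P" and ab: "a - b \<notin> P"
    and rel: "\<And>i. i \<in> A\<^sub>1 \<inter> A\<^sub>2 \<Longrightarrow> b * mvar (p\<^sub>1 i) - a * mvar (p\<^sub>2 i) \<in> P"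
    and zero: "\<And>i. i \<in> A\<^sub>2 - A\<^sub>1 \<Longrightarrow> mvar (p\<^sub>2 i) \<in> P"
    and ne: "A\<^sub>2 \<noteq> {}"
  obtains S where "\<And>j. mvar j \<notin> P \<Longrightarrow> \<exists>s\<in>S. \<exists>t. b ^ t * mvar j - a ^ t * mvar s \<in> P"
    and "(\<exists>c>0. a ^ c - b ^ c \<in> P) \<and> card S + card A\<^sub>2 div 2 \<le> CARD('n) \<or>
         card S + 1 + card A\<^sub>2 div 2 \<le> CARD('n)"
proof -
  interpret comm_prime_ideal P by (rule P)
  \<comment> \<open>That is, x_j = (a/b)^t x_s modulo \<open>P\<close>, with denominators
    cleared.\<close>
  define R where "R t s j \<longleftrightarrow> b ^ t * mvar j \<doteq> a ^ t * mvar s" for t s j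
  have R_trans: "R (t + u) s i" if "R t s j" "R u j i" for t u s i j
  proof -
    have "b ^ (t + u) * mvar i = b ^ t * (b ^ u * mvar i)"
      by (simp add: power_add mult.assoc)
    also have "\<dots> \<doteq> b ^ t * (a ^ u * mvar j)"
      using that(2) unfolding R_def by (rule eqmod_mult[OF eqmod_refl])
    also have "b ^ t * (a ^ u * mvar j) = a ^ u * (b ^ t * mvar j)"
      by (simp add: ac_simps)
    also have "\<dots> \<doteq> a ^ u * (a ^ t * mvar s)"
      using that(1) unfolding R_def by (rule eqmod_mult[OF eqmod_refl])
    also have "a ^ u * (a ^ t * mvar s) = a ^ (t + u) * mvar s"
      by (simp add: power_add ac_simps)
    finally show ?thesis unfolding R_def .
  qed
  have R_self: "a ^ t - b ^ t \<in> P" if "R t j j" "mvar j \<notin> P" for t j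
  proof -
    have "(b ^ t - a ^ t) * mvar j \<in> P"
      using that(1) by (simp add: R_def eqmod_def left_diff_distrib)
    then have "b ^ t - a ^ t \<in> P"
      using prime_mem that(2) by blast
    then show ?thesis
      using diff_mem[OF zero_mem] by fastforce
  qed
  define N where "N = {j :: 'n. mvar j \<notin> P}"
  define gen where "gen S \<longleftrightarrow> S \<subseteq> N \<and> (\<forall>j\<in>N. \<exists>s\<in>S. \<exists>t. R t s j)" for S
  have "R 0 j j" for j by (simp add: R_def)
  then have "gen N" unfolding gen_def by blast
  then obtain S where S: "gen S" and min: "\<And>S'. gen S' \<Longrightarrow> card S \<le> card S'"
    using ex_has_least_nat[of gen N card] by blast
  have SN: "S \<subseteq> N" and gen: "\<And>j. j \<in> N \<Longrightarrow> \<exists>s\<in>S. \<exists>t. R t s j"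
    using S by (auto simp: gen_def)
  \<comment> \<open>By minimality, an element reachable from another one could be dropped.\<close>
  have irredundant: "s = z" if "s \<in> S" "z \<in> S" "R t s z" for s z t
  proof (rule ccontr)
    assume "s \<noteq> z"
    have "\<exists>s\<in>S - {z}. \<exists>t. R t s j" if j: "j \<in> N" for j
    proof -
      obtain s' t' where "s' \<in> S" "R t' s' j" using gen[OF j] by blast
      then show ?thesis
        using R_trans[OF \<open>R t s z\<close>, of t' j] \<open>s \<noteq> z\<close> \<open>s \<in> S\<close> by (cases "s' = z") blast+
    qed
    then have "gen (S - {z})" using SN by (auto simp: gen_def)
    then have "card S \<le> card (S - {z})" by (rule min)
    then show False using \<open>z \<in> S\<close> card_Diff1_less[of S z] by simp
  qed
  \<comment> \<open>The edges between nonzero coordinates.\<close>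
  define E where "E = {i \<in> A\<^sub>1 \<inter> A\<^sub>2. p\<^sub>2 i \<in> N}"
  have edge: "R 1 (p\<^sub>2 i) (p\<^sub>1 i)" if "i \<in> E" for i
    using rel that by (simp add: R_def E_def eqmod_def)
  have E2: "p\<^sub>2 i \<in> N" if "i \<in> E" for i
    using that by (simp add: E_def)
  have E1: "p\<^sub>1 i \<in> N" if "i \<in> E" for i
  proof -
    have "a * mvar (p\<^sub>2 i) \<notin> P" using E2[OF that] a prime_mem by (auto simp: N_def)
    then have "b * mvar (p\<^sub>1 i) \<notin> P"
      using eqmod_mem edge[OF that] by (auto simp: R_def)
    then show ?thesis using mult_mem by (auto simp: N_def)
  qed
  \<comment> \<open>Indices of \<open>A\<^sub>2\<close> outside \<open>E\<close> yield distinct zero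
    coordinates \<open>p\<^sub>2 i\<close>, by \<open>zero\<close> or by the definition of
    \<open>E\<close>.\<close>
  have "card (A\<^sub>2 - E) \<le> card (- N)"
    using zero by (intro card_inj_on_le[of p\<^sub>2])
      (auto simp: E_def N_def intro: inj_on_subset[OF inj(2)])
  moreover have "card A\<^sub>2 = card E + card (A\<^sub>2 - E)"
    by (subst card_Un_disjoint[symmetric]) (auto simp: E_def intro: arg_cong[of _ _ card])
  moreover have "CARD('n) = card N + card (- N)"
    by (subst card_Un_disjoint[symmetric]) auto
  moreover have "card N = card S + card (N - S)"
    using SN by (subst card_Un_disjoint[symmetric]) (auto intro: arg_cong[of _ _ card])
  ultimately have count: "card S + card (N - S) + card A\<^sub>2 \<le> CARD('n) + card E"
    by linarith
  have "(\<exists>c>0. a ^ c - b ^ c \<in> P) \<and> card S + card A\<^sub>2 div 2 \<le> CARD('n) \<or>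
         card S + 1 + card A\<^sub>2 div 2 \<le> CARD('n)"
  proof (cases "\<exists>c>0. a ^ c - b ^ c \<in> P")
    case True
    \<comment> \<open>An edge within \<open>S\<close> would be a loop, forcing a/b = 1. So edges
      starting in \<open>S\<close> are counted by their ends and the others by their starts, and
      \<open>E\<close> has at most twice as many elements as \<open>N - S\<close>.\<close>
    have "card {i \<in> E. p\<^sub>2 i \<in> S} \<le> card (N - S)"
    proof (rule card_inj_on_le[of p\<^sub>1])
      have "p\<^sub>1 i \<notin> S" if i: "i \<in> E" "p\<^sub>2 i \<in> S" for i
      proof
        assume "p\<^sub>1 i \<in> S"
        then have "p\<^sub>2 i = p\<^sub>1 i" using irredundant i edge by blast
        then have "a ^ 1 - b ^ 1 \<in> P"
          using R_self[of 1 "p\<^sub>1 i"] edge[OF i(1)] E1[OF i(1)] by (simp add: N_def)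
        then show False using ab by simp
      qed
      then show "p\<^sub>1 ` {i \<in> E. p\<^sub>2 i \<in> S} \<subseteq> N - S" using E1 by blast
    qed (auto intro: inj_on_subset[OF inj(1)])
    moreover have "card {i \<in> E. p\<^sub>2 i \<notin> S} \<le> card (N - S)"
      using E2 by (intro card_inj_on_le[of p\<^sub>2]) (auto intro: inj_on_subset[OF inj(2)])
    moreover have "card E = card {i \<in> E. p\<^sub>2 i \<in> S} + card {i \<in> E. p\<^sub>2 i \<notin> S}"
      by (subst card_Un_disjoint[symmetric]) (auto intro: arg_cong[of _ _ card])
    moreover have "card (N - S) \<le> card N" by (intro card_mono) auto
    moreover have "card E \<le> card A\<^sub>2" by (intro card_mono) (auto simp: E_def)
    ultimately have "card S + card A\<^sub>2 div 2 \<le> CARD('n)"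
      using count by linarith
    then show ?thesis using True by blast
  next
    case False
    have "card E \<le> card (N - S)"
    proof (rule card_inj_on_le[of p\<^sub>1])
      have "p\<^sub>1 i \<notin> S" if i: "i \<in> E" for i
      proof
        assume z: "p\<^sub>1 i \<in> S"
        \<comment> \<open>Prolonging a path from \<open>S\<close> by an edge that ends in
          \<open>S\<close> must close a cycle, of positive length t + 1, so a/b would be a root of
          unity.\<close>
        obtain s t where "s \<in> S" "R t s (p\<^sub>2 i)" using gen E2[OF i] by blast
        then have "R (t + 1) s (p\<^sub>1 i)" using R_trans edge[OF i] by blast
        moreover from this have "s = p\<^sub>1 i" using irredundant \<open>s \<in> S\<close> z by blast
        ultimately have "a ^ (t + 1) - b ^ (t + 1) \<in> P"
          using E1[OF i] by (intro R_self[of _ "p\<^sub>1 i"]) (auto simp: N_def)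
        then show False using False by (meson add_gr_0 zero_less_one)
      qed
      then show "p\<^sub>1 ` E \<subseteq> N - S" using E1 by blast
    qed (auto intro: inj_on_subset[OF inj(1)])
    \<comment> \<open>Here card S + card \<open>A\<^sub>2\<close> is at most the number of
      coordinates; for nonempty \<open>A\<^sub>2\<close>, half of its size rounded up is at least 1
      and pays for the extra parameter.\<close>
    moreover have "card A\<^sub>2 > 0" using ne by (simp add: card_gt_0_iff)
    ultimately show ?thesis using count by linarith
  qed
  moreover have "\<exists>s\<in>S. \<exists>t. b ^ t * mvar j - a ^ t * mvar s \<in> P" if "mvar j \<notin> P" for j
    using gen[of j] that by (simp add: N_def R_def eqmod_def)
  ultimately show ?thesis using that by blast
qed

section \<open>Krull dimension via chains of primes\<close>

lemma topspace_zariski_polring: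
  "topspace (zariski_topology polring) = Spec (polring :: ('n::finite, 'k::field) mpol ring)"
proof
  show "topspace (zariski_topology polring) \<subseteq> Spec (polring :: ('n, 'k) mpol ring)"
    unfolding topspace_def openin_zariski by blast
  have "\<not> UNIV \<subseteq> P" if "P \<in> Spec (polring :: ('n, 'k) mpol ring)" for P
    using that comm_prime_ideal.one_not_mem by (auto simp: Spec_def primeideal_iff_comm_prime_ideal)
  then have "openin (zariski_topology polring) (Spec (polring :: ('n, 'k) mpol ring))"
    unfolding openin_zariski by (intro exI[of _ UNIV]) (auto simp: polring_def)
  then show "Spec (polring :: ('n, 'k) mpol ring) \<subseteq> topspace (zariski_topology polring)"
    by (rule openin_subset)
qed

lemma closedin_zariski_subtopology_polring:
  fixes U :: "('n::finite, 'k::field) mpol set set"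
  assumes U: "U \<subseteq> Spec polring"
  shows "closedin (subtopology (zariski_topology polring) U) Z \<longleftrightarrow> (\<exists>S. Z = {P \<in> U. S \<subseteq> P})"
proof
  assume "closedin (subtopology (zariski_topology polring) U) Z"
  then obtain T where T: "closedin (zariski_topology polring) T" "Z = T \<inter> U"
    by (auto simp: closedin_subtopology)
  then obtain S where "Spec polring - T = {P \<in> Spec polring. \<not> S \<subseteq> P}"
    by (auto simp: closedin_def openin_zariski topspace_zariski_polring)
  then have "Z = {P \<in> U. S \<subseteq> P}"
    using T(2) U by blast
  then show "\<exists>S. Z = {P \<in> U. S \<subseteq> P}" ..
next
  assume "\<exists>S. Z = {P \<in> U. S \<subseteq> P}"
  then obtain S where S: "Z = {P \<in> U. S \<subseteq> P}" ..
  have "closedin (zariski_topology polring) {P \<in> Spec polring. S \<subseteq> P}"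
    unfolding closedin_def openin_zariski topspace_zariski_polring
    by (intro conjI exI[of _ S]) (auto simp: polring_def)
  moreover have "Z = {P \<in> Spec polring. S \<subseteq> P} \<inter> U"
    using S U by blast
  ultimately show "closedin (subtopology (zariski_topology polring) U) Z"
    by (auto simp: closedin_subtopology)
qed

text \<open>If f g lies in all points of \<open>Z\<close>, the points containing f and those
  containing g are closed sets covering \<open>Z\<close>, so one of them is all of
  \<open>Z\<close>.\<close>

lemma irreducible_closedin_generic_point:
  fixes U :: "('n::finite, 'k::field) mpol set set"
  assumes U: "U \<subseteq> Spec polring"
    and Z: "irreducible_closedin (subtopology (zariski_topology polring) U) Z"
  shows "comm_prime_ideal (\<Inter>Z)" and "Z = {P \<in> U. \<Inter>Z \<subseteq> P}"
proof -
  note closed = closedin_zariski_subtopology_polring[OF U]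
  obtain S where S: "Z = {P \<in> U. S \<subseteq> P}"
    using Z closed by (auto simp: irreducible_closedin_def)
  then show eq: "Z = {P \<in> U. \<Inter>Z \<subseteq> P}" by blast
  have ne: "Z \<noteq> {}" using Z by (simp add: irreducible_closedin_def)
  have prime: "comm_prime_ideal P" if "P \<in> Z" for P
    using that U eq by (auto simp: Spec_def primeideal_iff_comm_prime_ideal)
  show "comm_prime_ideal (\<Inter>Z)"
  proof
    fix f g assume fg: "f * g \<in> \<Inter>Z"
    define A B where "A = {P \<in> U. insert f S \<subseteq> P}" and "B = {P \<in> U. insert g S \<subseteq> P}"
    have "Z = A \<union> B"
      using fg comm_prime_ideal.prime_mem[OF prime] unfolding A_def B_def S by blast
    moreover have "closedin (subtopology (zariski_topology polring) U) A"
      "closedin (subtopology (zariski_topology polring) U) B"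
      unfolding closed A_def B_def by blast+
    ultimately have "A = Z \<or> B = Z"
      using Z unfolding irreducible_closedin_def by blast
    then show "f \<in> \<Inter>Z \<or> g \<in> \<Inter>Z"
      by (auto simp: A_def B_def)
  next
    show "1 \<notin> \<Inter>Z" using ne prime comm_prime_ideal.one_not_mem by blast
  qed (use prime in \<open>auto intro: comm_prime_ideal.zero_mem comm_prime_ideal.add_mem
    comm_prime_ideal.mult_mem\<close>)
qed

text \<open>It is enough to remember that \<open>Q 0\<close> is the intersection of a nonempty
  family of points of \<open>U\<close>: the conditions defining \<open>U\<close> can then be
  transferred to \<open>Q 0\<close>.\<close>

lemma krull_dim_le_of_prime_chains:
  fixes U :: "('n::finite, 'k::field) mpol set set"
  assumes U: "U \<subseteq> Spec polring"
    and chains: "\<And>l Q Z. \<lbrakk>Z \<subseteq> U; Z \<noteq> {}; Q 0 = \<Inter>Z; \<And>i. i \<le> l \<Longrightarrow> comm_prime_ideal (Q i);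
      \<And>i. i < l \<Longrightarrow> Q i \<subset> Q (Suc i)\<rbrakk> \<Longrightarrow> real l \<le> x"
  shows "krull_dim (subtopology (zariski_topology polring) U) \<le> ereal x"
proof -
  have "real l \<le> x"
    if irr: "\<forall>i\<le>l. irreducible_closedin (subtopology (zariski_topology polring) U) (Z i)"
      and strict: "\<forall>i<l. Z i \<subset> Z (Suc i)" for l Z
  proof (rule chains[of "Z l" "\<lambda>i. \<Inter>(Z (l - i))" l])
    \<comment> \<open>Intersection reverses inclusions, so the prime chain starts at the largest set
      \<open>Z l\<close>. Each set is recovered from its intersection, which keeps inclusions
      strict.\<close>
    have closed: "Z i = {P \<in> U. \<Inter>(Z i) \<subseteq> P}" if "i \<le> l" for i
      using irreducible_closedin_generic_point(2)[OF U] irr that by blast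
    show "Z l \<subseteq> U" using closed[of l] by blast
    show "Z l \<noteq> {}" using irr by (simp add: irreducible_closedin_def)
    show "comm_prime_ideal (\<Inter>(Z (l - i)))" for i
      using irreducible_closedin_generic_point(1)[OF U] irr by simp
    show "\<Inter>(Z (l - i)) \<subset> \<Inter>(Z (l - Suc i))" if "i < l" for i
    proof -
      have "Z (l - Suc i) \<subset> Z (l - i)"
        using strict[rule_format, of "l - Suc i"] that by (simp add: Suc_diff_Suc)
      moreover from this have "\<Inter>(Z (l - i)) \<noteq> \<Inter>(Z (l - Suc i))"
        using closed[of "l - i"] closed[of "l - Suc i"] by force
      ultimately show ?thesis by blast
    qed
  qed simp
  then show ?thesis
    unfolding krull_dim_def by (intro Sup_least) auto
qed

section \<open>The points of the determinantal scheme\<close>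

lemma ideal_vanishing_ideal: "ideal (vanishing_ideal V) polring"
  by (rule ideal_polringI) (auto simp: vanishing_ideal_def meval_add meval_mult)

text \<open>A prime contains a generated ideal iff it contains the generators, so only the minors
  themselves remain.\<close>

lemma mem_U_points_iff:
  fixes \<sigma>\<^sub>1 \<sigma>\<^sub>2 :: "'k::field ^ 'n::finite \<Rightarrow> 'k ^ 'n"
  shows "P \<in> U_points \<sigma>\<^sub>1 \<sigma>\<^sub>2 \<longleftrightarrow> P \<in> Spec polring \<and> two_minors (generic_pair \<sigma>\<^sub>1 \<sigma>\<^sub>2) \<subseteq> P \<and>
     \<not> vanishing_ideal {v. \<sigma>\<^sub>1 v - \<sigma>\<^sub>2 v = 0} \<subseteq> P \<and> \<not> vanishing_ideal {v. \<sigma>\<^sub>1 v = 0} \<subseteq> P \<and>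
     \<not> vanishing_ideal {v. \<sigma>\<^sub>2 v = 0} \<subseteq> P"
proof -
  interpret R: cring "polring :: ('n, 'k) mpol ring" by (rule cring_polring)
  let ?M = "two_minors (generic_pair \<sigma>\<^sub>1 \<sigma>\<^sub>2)"
  have M: "?M \<subseteq> carrier polring" by (simp add: polring_def)
  have "Idl\<^bsub>polring\<^esub> ?M \<subseteq> P \<longleftrightarrow> ?M \<subseteq> P" if "P \<in> Spec polring"
    using R.genideal_minimal[of P ?M] R.genideal_self[OF M] that
    by (auto simp: Spec_def primeideal_def)
  then show ?thesis
    unfolding U_points_def closure_scheme_def minor_ideal_def
      R.Spec_quot_eq[OF ideal_vanishing_ideal] R.Spec_quot_eq[OF R.genideal_ideal[OF M]]
    by blast
qed

lemma generic_image_coord: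
  fixes \<sigma> :: "'k::field ^ 'n::finite \<Rightarrow> 'k ^ 'n"
  assumes "\<And>v i. \<sigma> v $ i = (if i \<in> A then v $ p i else 0)"
  shows "generic_image \<sigma> $ i = (if i \<in> A then mvar (p i) else 0)"
proof -
  have "generic_image \<sigma> $ i = (\<Sum>j\<in>UNIV. mconst (\<sigma> (axis j 1) $ i) * mvar j)"
    by (simp add: generic_image_def matrix_vector_mult_def matrix_def)
  also have "\<dots> = (\<Sum>j\<in>UNIV. if j = p i then if i \<in> A then mvar j else 0 else 0)"
    by (intro sum.cong) (auto simp: assms axis_def)
  finally show ?thesis by simp
qed

lemma two_minors_generic_pair:
  assumes "i \<noteq> j"
  shows "generic_image \<sigma>\<^sub>1 $ i * generic_image \<sigma>\<^sub>2 $ j - generic_image \<sigma>\<^sub>2 $ i * generic_image \<sigma>\<^sub>1 $ j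
    \<in> two_minors (generic_pair \<sigma>\<^sub>1 \<sigma>\<^sub>2)"
  unfolding two_minors_def using assms
  by (intro CollectI exI[of _ i] exI[of _ j]) (simp add: det_2 generic_pair_def)

text \<open>All rows lie in the coordinate subspace of \<open>A\<close>. This direction passes from
  \<open>card A\<close> to the rank in the dimension bound.\<close>

lemma rank_coord_projection_le:
  "rank (matrix (\<lambda>v :: 'k::field ^ 'n::finite. \<chi> i. if i \<in> A then v $ i else 0)) \<le> card A"
proof -
  let ?M = "matrix (\<lambda>v :: 'k ^ 'n. \<chi> i. if i \<in> A then v $ i else 0)"
  have "rows ?M \<subseteq> {x. \<forall>i. i \<notin> A \<longrightarrow> x $ i = 0}"
    by (auto simp: rows_def row_def matrix_def axis_def)
  then have "vec.dim (rows ?M) \<le> vec.dim {x :: 'k ^ 'n. \<forall>i. i \<notin> A \<longrightarrow> x $ i = 0}"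
    by (rule vec.dim_subset)
  then show ?thesis
    by (simp add: row_rank_def_gen dim_substandard_cart)
qed

section \<open>Assembling the dimension bound\<close>

theorem theorem1p2:
  fixes \<pi>\<^sub>1 \<pi>\<^sub>2 \<rho>\<^sub>1 \<rho>\<^sub>2 :: "'k::field ^ 'n::finite \<Rightarrow> 'k ^ 'n"
  assumes "infinite (UNIV :: 'k set)"
    and "coord_permutation \<pi>\<^sub>1" and "coord_permutation \<pi>\<^sub>2"
    and "coord_projection \<rho>\<^sub>1" and "coord_projection \<rho>\<^sub>2"
  shows "krull_dim (U_space (\<rho>\<^sub>2 \<circ> \<rho>\<^sub>1 \<circ> \<pi>\<^sub>1) (\<rho>\<^sub>2 \<circ> \<pi>\<^sub>2))
           \<le> ereal (real CARD('n) - real (rank (matrix \<rho>\<^sub>2) div 2))"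
proof -
  obtain p\<^sub>1 p\<^sub>2 where p: "p\<^sub>1 permutes UNIV" "p\<^sub>2 permutes UNIV"
    and \<pi>: "\<pi>\<^sub>1 = (\<lambda>v. \<chi> i. v $ p\<^sub>1 i)" "\<pi>\<^sub>2 = (\<lambda>v. \<chi> i. v $ p\<^sub>2 i)"
    using assms(2,3) unfolding coord_permutation_def by blast
  obtain A\<^sub>1 A\<^sub>2 where \<rho>: "\<rho>\<^sub>1 = (\<lambda>v. \<chi> i. if i \<in> A\<^sub>1 then v $ i else 0)"
    "\<rho>\<^sub>2 = (\<lambda>v. \<chi> i. if i \<in> A\<^sub>2 then v $ i else 0)"
    using assms(4,5) unfolding coord_projection_def by blast
  define \<sigma>\<^sub>1 \<sigma>\<^sub>2 where "\<sigma>\<^sub>1 = \<rho>\<^sub>2 \<circ> \<rho>\<^sub>1 \<circ> \<pi>\<^sub>1" and "\<sigma>\<^sub>2 = \<rho>\<^sub>2 \<circ> \<pi>\<^sub>2"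
  have \<sigma>: "\<sigma>\<^sub>1 v $ i = (if i \<in> A\<^sub>1 \<inter> A\<^sub>2 then v $ p\<^sub>1 i else 0)"
    "\<sigma>\<^sub>2 v $ i = (if i \<in> A\<^sub>2 then v $ p\<^sub>2 i else 0)" for v i
    by (simp_all add: \<sigma>\<^sub>1_def \<sigma>\<^sub>2_def \<pi> \<rho>)
  note generic = generic_image_coord[of \<sigma>\<^sub>1, OF \<sigma>(1)] generic_image_coord[of \<sigma>\<^sub>2, OF \<sigma>(2)]
  have rank: "rank (matrix \<rho>\<^sub>2) \<le> card A\<^sub>2"
    unfolding \<rho> by (rule rank_coord_projection_le)
  have "krull_dim (U_space \<sigma>\<^sub>1 \<sigma>\<^sub>2) \<le> ereal (real CARD('n) - real (rank (matrix \<rho>\<^sub>2) div 2))"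
    unfolding U_space_def
  proof (rule krull_dim_le_of_prime_chains)
    show "U_points \<sigma>\<^sub>1 \<sigma>\<^sub>2 \<subseteq> Spec polring"
      using mem_U_points_iff by blast
    fix l Z and Q :: "nat \<Rightarrow> ('n, 'k) mpol set"
    assume Z: "Z \<subseteq> U_points \<sigma>\<^sub>1 \<sigma>\<^sub>2" "Z \<noteq> {}" "Q 0 = \<Inter>Z"
      and chain: "\<And>i. i \<le> l \<Longrightarrow> comm_prime_ideal (Q i)" "\<And>i. i < l \<Longrightarrow> Q i \<subset> Q (Suc i)"
    have P: "comm_prime_ideal (Q 0)" using chain by simp
    interpret comm_prime_ideal "Q 0" by (rule P)
    have minors: "two_minors (generic_pair \<sigma>\<^sub>1 \<sigma>\<^sub>2) \<subseteq> Q 0"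
      using Z mem_U_points_iff by blast
    \<comment> \<open>An ideal not contained in the larger prime \<open>P'\<close> is not contained
      in \<open>Q 0\<close> either.\<close>
    obtain P' where "P' \<in> U_points \<sigma>\<^sub>1 \<sigma>\<^sub>2" "Q 0 \<subseteq> P'"
      using Z by blast
    then have kers: "\<not> vanishing_ideal {v. \<sigma>\<^sub>1 v - \<sigma>\<^sub>2 v = 0} \<subseteq> Q 0"
      "\<not> vanishing_ideal {v. \<sigma>\<^sub>1 v = 0} \<subseteq> Q 0" "\<not> vanishing_ideal {v. \<sigma>\<^sub>2 v = 0} \<subseteq> Q 0"
      using mem_U_points_iff by blast+
    note vanishing = vanishing_ideal_subset[OF assms(1) P]
    \<comment> \<open>Otherwise all equations of the kernel hold modulo \<open>Q 0\<close>, which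
      would then contain its vanishing ideal.\<close>
    have "\<exists>i\<in>A\<^sub>1 \<inter> A\<^sub>2. mvar (p\<^sub>1 i) \<notin> Q 0"
    proof (rule ccontr)
      assume "\<not> ?thesis"
      then have "vanishing_ideal {v. \<sigma>\<^sub>1 v = 0} \<subseteq> Q 0"
        by (intro vanishing) (auto simp: vec_eq_iff \<sigma>)
      with kers show False by blast
    qed
    then obtain o\<^sub>1 where o1: "o\<^sub>1 \<in> A\<^sub>1 \<inter> A\<^sub>2" "mvar (p\<^sub>1 o\<^sub>1) \<notin> Q 0" by blast
    have "\<exists>i\<in>A\<^sub>2. mvar (p\<^sub>2 i) \<notin> Q 0"
    proof (rule ccontr)
      assume "\<not> ?thesis"
      then have "vanishing_ideal {v. \<sigma>\<^sub>2 v = 0} \<subseteq> Q 0"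
        by (intro vanishing) (auto simp: vec_eq_iff \<sigma>)
      with kers show False by blast
    qed
    then obtain o\<^sub>2 where o2: "o\<^sub>2 \<in> A\<^sub>2" "mvar (p\<^sub>2 o\<^sub>2) \<notin> Q 0" by blast
    \<comment> \<open>Row \<open>o\<^sub>1\<close> supplies numerator and denominator of the
      ratio.\<close>
    define a b :: "('n, 'k) mpol" where "a = mvar (p\<^sub>1 o\<^sub>1)" and "b = mvar (p\<^sub>2 o\<^sub>1)"
    \<comment> \<open>The minor of rows \<open>o\<^sub>1\<close> and \<open>i\<close>; for equal
      rows the expression is a b - b a = 0.\<close>
    have minor: "a * mvar (p\<^sub>2 i) - b * generic_image \<sigma>\<^sub>1 $ i \<in> Q 0" if "i \<in> A\<^sub>2" for i
      using two_minors_generic_pair[of o\<^sub>1 i \<sigma>\<^sub>1 \<sigma>\<^sub>2] minors o1 that zero_mem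
      by (cases "i = o\<^sub>1") (auto simp: generic a_def b_def)
    have a: "a \<notin> Q 0" using o1 by (simp add: a_def)
    \<comment> \<open>If b were 0 modulo \<open>Q 0\<close>, the minors would make the whole vector
      of \<open>\<sigma>\<^sub>2\<close> vanish, against the choice of
      \<open>o\<^sub>2\<close>.\<close>
    have b: "b \<notin> Q 0"
    proof
      assume "b \<in> Q 0"
      then have "a * mvar (p\<^sub>2 o\<^sub>2) \<in> Q 0"
        using add_mem[OF minor[OF o2(1)] mult_mem'[of b "generic_image \<sigma>\<^sub>1 $ o\<^sub>2"]] by simp
      then show False using a o2(2) prime_mem by blast
    qed
    have rel: "b * mvar (p\<^sub>1 i) - a * mvar (p\<^sub>2 i) \<in> Q 0" if "i \<in> A\<^sub>1 \<inter> A\<^sub>2" for i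
      using diff_mem[OF zero_mem minor[of i]] that by (simp add: generic)
    have zero: "mvar (p\<^sub>2 i) \<in> Q 0" if "i \<in> A\<^sub>2 - A\<^sub>1" for i
      using minor[of i] that a prime_mem by (auto simp: generic)
    \<comment> \<open>Ratio 1 would make both images equal modulo \<open>Q 0\<close>, which the
      removal of the kernel of the difference excludes.\<close>
    have ab: "a - b \<notin> Q 0"
    proof
      assume ab: "a - b \<in> Q 0"
      have eq: "mvar (p\<^sub>1 i) - mvar (p\<^sub>2 i) \<in> Q 0" if i: "i \<in> A\<^sub>1 \<inter> A\<^sub>2" for i
      proof -
        have "b * (mvar (p\<^sub>1 i) - mvar (p\<^sub>2 i)) \<in> Q 0"
          using add_mem[OF rel[OF i] mult_mem'[OF ab, of "mvar (p\<^sub>2 i)"]] by (simp add: algebra_simps)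
        then show ?thesis using b prime_mem by blast
      qed
      have "vanishing_ideal {v. \<sigma>\<^sub>1 v - \<sigma>\<^sub>2 v = 0} \<subseteq> Q 0"
        by (rule vanishing) (use eq zero in \<open>auto simp: vec_eq_iff \<sigma>\<close>)
      then show False using kers by blast
    qed
    obtain S where S: "\<And>j. mvar j \<notin> Q 0 \<Longrightarrow> \<exists>s\<in>S. \<exists>t. b ^ t * mvar j - a ^ t * mvar s \<in> Q 0"
      and card: "(\<exists>c>0. a ^ c - b ^ c \<in> Q 0) \<and> card S + card A\<^sub>2 div 2 \<le> CARD('n) \<or>
         card S + 1 + card A\<^sub>2 div 2 \<le> CARD('n)"
      using exists_small_generators[OF P permutes_inj[OF p(1)] permutes_inj[OF p(2)] a b ab rel zero] o2(1)
      by blast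
    note length = prime_chain_length_le_generators[of l Q b S a, OF chain b S]
    from card have "l + card A\<^sub>2 div 2 \<le> CARD('n)"
    proof (elim disjE conjE)
      assume "\<exists>c>0. a ^ c - b ^ c \<in> Q 0" and card: "card S + card A\<^sub>2 div 2 \<le> CARD('n)"
      then have "l \<le> card S" using length(2) by blast
      then show ?thesis using card by linarith
    next
      assume "card S + 1 + card A\<^sub>2 div 2 \<le> CARD('n)"
      then show ?thesis using length(1) by linarith
    qed
    moreover have "rank (matrix \<rho>\<^sub>2) div 2 \<le> card A\<^sub>2 div 2"
      using rank by (rule div_le_mono)
    ultimately show "real l \<le> real CARD('n) - real (rank (matrix \<rho>\<^sub>2) div 2)"
      by linarith
  qed
  then show ?thesis by (simp only: \<sigma>\<^sub>1_def \<sigma>\<^sub>2_def)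
qed

end
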